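(* Let $n\ge 2$ and let $U$ be an arbitrary $2^n\times 2^n$ unitary matrix. Among all fixed-column orderings for the two-level decomposition of $U$, the ordering $array_n$ used by the Palindromic Optimization Algorithm achieves the maximal total length of overlaps between successive palindromic subcircuits (that is, it maximizes the sum, over all consecutive pairs of subcircuits in the entire generated sequence, of the lengths of their overlaps), and thus the circuit it produces has, after cancellation of the overlaps, the minimum number of $\Lambda_{n-1}(X)$ gates among the circuits of $(n-1)$-controlled single-qubit and $(n-1)$-controlled-NOT gates generated from fixed-column orderings.
   Context: Indices (rows, columns, basis states) run over $0,1,\ldots,2^n-1$ and are identified with their $n$-bit binary expansions; bit $k$ is the coefficient of $2^k$. Fixed-column ordering: a sequence of all pairs $(r,c)$ with $0\le c<r\le 2^n-1$ in which all pairs with column $c=0$ come first, then all those with $c=1$, and so on up to $c=2^n-2$; within each column $c$ the rows $r\in\{c+1,\ldots,2^n-1\}$ may appear in any order. Two-level decomposition of $U$ in a given fixed-column ordering produces $U=V_1\cdots V_k$, $k=2^{n-1}(2^n-1)$, where if the $j$-th pair is $(r,c)$ then $V_j$ is a unitary matrix acting nontrivially only on the vector components $c,r$, with $2\times2$ component matrix $\tilde V_j$; $V_j$ is chosen as the adjoint of a matrix $M_j$ such that left multiplication by $M_j$ zeroes entry $(r,c)$ of $M_{j-1}\cdots M_1U$ (Givens elimination; if the entry is already zero $M_j$ may be the identity, and it is still output). Gates: an $(n-1)$-controlled gate $\Lambda_{n-1}(S)$ applies the single-qubit gate $S$ to one target bit, conditional on the other $n-1$ bits having prescribed values (each control being on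 0 or on 1). Two $\Lambda_{n-1}(X)$ gates ($X$ = NOT) are the same iff they have the same target and the same prescribed values of the other bits; each is self-inverting. $GrayCode(c,r)$ is the sequence $g_1=c,g_2,\ldots,g_m=r$ in which $g_{i+1}$ is obtained from $g_i$ by flipping the rightmost (least significant) bit in which $g_i$ differs from $r$. The palindromic subcircuit $PS(c,r)$ generated for the pair $(r,c)$ is $$X_1X_2\ldots X_{m-2}\,\beta\,X_{m-2}\ldots X_2X_1,$$ where $X_i$ is the $\Lambda_{n-1}(X)$ gate whose target is the bit in which $g_i$ and $g_{i+1}$ differ, conditional on the other bits being as in $g_i$, and $\beta$ is the gate $\Lambda_{n-1}(\tilde V_j)$ targeting the bit in which $g_{m-1}$ and $g_m$ differ, conditional on the other bits being as in $g_m$. Middle gates $\beta$ are treated as generic gates and never cancel. The circuit generated from an ordering is the concatenation of the subcircuits $PS(c,r)$ in that order. Overlap: for consecutive subcircuits $\alpha_1\beta_1\alpha_1^R$ and $\alpha_2\beta_2\alpha_2^R$ ($\alpha^R$ denotes the reversal of the string $\alpha$), the overlap is the longest prefix $\gamma$ of $\alpha_2$ such that $\gamma^R$ is a suffix of $\alpha_1^R$, i.e. the longest common prefix of $\alpha_1$ and $\alpha_2$. The sequence $\gamma^R\gamma$ between $\beta_1$ and $\beta_2$ then cancels, removing $2\,length(\gamma)$ $\Lambda_{n-1}(X)$ gates. Palindromic Optimization Algorithm (POA): it uses the fixed-column ordering in which the rows of column $c$ appear in the order given by the sequence $R_n^c$, where $R_2^0=(1,2,3)$, $R_2^1=(2,3)$,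 $R_2^2=(3)$, $R_2^3=()$ and, for $m\ge3$ and $0\le c\le 2^{m-1}-1$, $$R_m^{2c}=\bigl(2R_{m-1}^c,\;2c+1,\;2R_{m-1}^c+1\bigr),\qquad R_m^{2c+1}=\bigl(2R_{m-1}^c,\;2R_{m-1}^c+1\bigr)$$ (concatenation of sequences; $2R$ and $2R+1$ mean the map $x\mapsto 2x$, resp. $x\mapsto 2x+1$, applied to each term of $R$). The array with columns $R_n^c$ is called $array_n$. *)

theory Defs
  imports
    "HOL-Library.Sublist"
    "Jordan_Normal_Form.Schur_Decomposition"
begin

section \<open>Fixed-column orderings\<close>

text \<open>
  A pair \<open>(r, c)\<close> stands for the matrix entry in row \<open>r\<close> and column \<open>c\<close>. All indices are natural
  numbers below \<open>2 ^ n\<close>, and \<open>bit x k\<close> is the coefficient of \<open>2 ^ k\<close> in the binary expansion.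
\<close>

definition fixed_column_ordering :: "nat \<Rightarrow> (nat \<times> nat) list \<Rightarrow> bool" where
  "fixed_column_ordering n ps \<longleftrightarrow>
     distinct ps \<and> set ps = {(r, c). c < r \<and> r < 2 ^ n} \<and> sorted (map snd ps)"

text \<open>The sequence \<open>R\<^sub>m\<^sup>c\<close>; the values for \<open>m < 2\<close> are irrelevant.\<close>

fun poa_rows :: "nat \<Rightarrow> nat \<Rightarrow> nat list" where
  "poa_rows 0 c = []"
| "poa_rows (Suc 0) c = []"
| "poa_rows (Suc (Suc 0)) c =
     (if c = 0 then [1, 2, 3] else if c = 1 then [2, 3] else if c = 2 then [3] else [])"
| "poa_rows (Suc (Suc (Suc m))) c =
     (let R = poa_rows (Suc (Suc m)) (c div 2) in
      if even c
      then map (\<lambda>x. 2 * x) R @ [c + 1] @ map (\<lambda>x. 2 * x + 1) R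
      else map (\<lambda>x. 2 * x) R @ map (\<lambda>x. 2 * x + 1) R)"

definition poa_ordering :: "nat \<Rightarrow> (nat \<times> nat) list" where
  "poa_ordering n = concat (map (\<lambda>c. map (\<lambda>r. (r, c)) (poa_rows n c)) [0..<2 ^ n - 1])"


section \<open>Two-level decompositions\<close>

definition unitary_matrix :: "nat \<Rightarrow> complex mat \<Rightarrow> bool" where
  "unitary_matrix N U \<longleftrightarrow>
     U \<in> carrier_mat N N \<and> mat_adjoint U * U = 1\<^sub>m N \<and> U * mat_adjoint U = 1\<^sub>m N"

definition two_level_unitary :: "nat \<Rightarrow> nat \<Rightarrow> nat \<Rightarrow> complex mat \<Rightarrow> bool" where
  "two_level_unitary N c r V \<longleftrightarrow>
     unitary_matrix N V \<and>
     (\<forall>i<N. \<forall>j<N. \<not> (i \<in> {c, r} \<and> j \<in> {c, r}) \<longrightarrow> V $$ (i, j) = (if i = j then 1 else 0))"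

definition component_matrix :: "nat \<Rightarrow> nat \<Rightarrow> complex mat \<Rightarrow> complex mat" where
  "component_matrix c r V =
     mat_of_rows_list 2 [[V $$ (c, c), V $$ (c, r)], [V $$ (r, c), V $$ (r, r)]]"

text \<open>\<open>eliminate [V\<^sub>1, \<dots>, V\<^sub>j] U = M\<^sub>j \<cdots> M\<^sub>1 U\<close>, where \<open>M\<^sub>i\<close> is the adjoint of \<open>V\<^sub>i\<close>.\<close>

definition eliminate :: "complex mat list \<Rightarrow> complex mat \<Rightarrow> complex mat" where
  "eliminate Vs U = fold (\<lambda>V A. mat_adjoint V * A) Vs U"

text \<open>
  The factors are not determined by \<open>U\<close> and the ordering (each \<open>M\<^sub>j\<close> is only required to zero one
  entry), so a decomposition is a relation rather than a function. The last condition says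
  \<open>U = V\<^sub>1 \<cdots> V\<^sub>k\<close>; it constrains the phases of the factors.
\<close>

definition two_level_decomposition ::
  "nat \<Rightarrow> complex mat \<Rightarrow> (nat \<times> nat) list \<Rightarrow> complex mat list \<Rightarrow> bool" where
  "two_level_decomposition n U ps Vs \<longleftrightarrow>
     length Vs = length ps \<and>
     (\<forall>j<length ps. case ps ! j of (r, c) \<Rightarrow>
        two_level_unitary (2 ^ n) c r (Vs ! j) \<and>
        eliminate (take (Suc j) Vs) U $$ (r, c) = 0) \<and>
     U = foldr (*) Vs (1\<^sub>m (2 ^ n))"


section \<open>Gates and palindromic subcircuits\<close>

text \<open>
  Both constructors carry the target bit and the prescribed control values. The middle gates have a
  constructor of their own, so that they are never counted as controlled-NOT gates, whatever
  their component matrix is.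
\<close>

datatype gate =
    is_CNOT: CNOT nat "nat \<rightharpoonup> bool"
  | CU "complex mat" nat "nat \<rightharpoonup> bool"

definition controls :: "nat \<Rightarrow> nat \<Rightarrow> nat \<Rightarrow> (nat \<rightharpoonup> bool)" where
  "controls n t g = (\<lambda>k. if k < n \<and> k \<noteq> t then Some (bit g k) else None)"

definition lowest_diff :: "nat \<Rightarrow> nat \<Rightarrow> nat" where
  "lowest_diff g r = (LEAST k. bit g k \<noteq> bit r k)"

lemma flip_lowest_diff_less:
  includes bit_operations_syntax
  assumes "g \<noteq> r"
  shows "flip_bit (lowest_diff g r) g XOR r < g XOR r"
proof -
  let ?k = "lowest_diff g r"
  from assms obtain k where "bit g k \<noteq> bit r k"
    by (auto simp: bit_eq_iff)
  then have k: "bit g ?k \<noteq> bit r ?k"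
    unfolding lowest_diff_def by (rule LeastI)
  have "g XOR r = (flip_bit ?k g XOR r) OR 2 ^ ?k"
    using k by (intro bit_eqI) (auto simp: bit_simps)
  also have "\<dots> = (flip_bit ?k g XOR r) + 2 ^ ?k"
    using k by (intro disjunctive_add_eq_or [symmetric] bit_eqI) (auto simp: bit_simps)
  finally show ?thesis by simp
qed

function gray_code :: "nat \<Rightarrow> nat \<Rightarrow> nat list" where
  "gray_code g r = (if g = r then [g] else g # gray_code (flip_bit (lowest_diff g r) g) r)"
  by auto
termination
  by (relation "measure (\<lambda>(g, r). Bit_Operations.xor g r)") (simp_all add: flip_lowest_diff_less)

declare gray_code.simps [simp del]

text \<open>The half \<open>X\<^sub>1 \<dots> X\<^sub>m\<^sub>-\<^sub>2\<close> of the palindrome. Consecutive code words differ in one bit only.\<close>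

definition palindrome_half :: "nat \<Rightarrow> nat \<Rightarrow> nat \<Rightarrow> gate list" where
  "palindrome_half n c r =
     (let g = gray_code c r in
      map (\<lambda>i. let t = lowest_diff (g ! i) (g ! Suc i) in CNOT t (controls n t (g ! i)))
        [0..<length g - 2])"

text \<open>
  The target bit is the most significant bit in which \<open>c < r\<close> differ; it is 0 in \<open>c\<close> and 1 in \<open>r\<close>,
  so the component matrix with respect to the ordered pair \<open>(c, r)\<close> is the right one.
\<close>

definition middle_gate :: "nat \<Rightarrow> nat \<Rightarrow> nat \<Rightarrow> complex mat \<Rightarrow> gate" where
  "middle_gate n c r V =
     (let g = gray_code c r;
          m = length g;
          t = lowest_diff (g ! (m - 2)) (g ! (m - 1))
      in CU (component_matrix c r V) t (controls n t (g ! (m - 1))))"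

text \<open>A subcircuit \<open>\<alpha> \<beta> \<alpha>\<^sup>R\<close> is represented by the pair \<open>(\<alpha>, \<beta>)\<close>.\<close>

definition subcircuits ::
  "nat \<Rightarrow> (nat \<times> nat) list \<Rightarrow> complex mat list \<Rightarrow> (gate list \<times> gate) list" where
  "subcircuits n ps Vs =
     map2 (\<lambda>(r, c) V. (palindrome_half n c r, middle_gate n c r V)) ps Vs"

definition circuit :: "(gate list \<times> gate) list \<Rightarrow> gate list" where
  "circuit Ss = concat (map (\<lambda>(\<alpha>, \<beta>). \<alpha> @ [\<beta>] @ rev \<alpha>) Ss)"


section \<open>Overlaps and their cancellation\<close>

definition overlap :: "gate list \<Rightarrow> gate list \<Rightarrow> gate list" where
  "overlap \<alpha>\<^sub>1 \<alpha>\<^sub>2 = (ARG_MAX length \<gamma>. prefix \<gamma> \<alpha>\<^sub>2 \<and> suffix (rev \<gamma>) (rev \<alpha>\<^sub>1))"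

lemma overlap_eq_Longest_common_prefix: "overlap \<alpha>\<^sub>1 \<alpha>\<^sub>2 = Longest_common_prefix {\<alpha>\<^sub>1, \<alpha>\<^sub>2}"
  by (simp add: overlap_def Longest_common_prefix_def suffix_to_prefix conj_commute)

definition total_overlap :: "nat \<Rightarrow> (nat \<times> nat) list \<Rightarrow> nat" where
  "total_overlap n ps =
     (let \<alpha>s = map (\<lambda>(r, c). palindrome_half n c r) ps
      in \<Sum>j<length \<alpha>s - 1. length (overlap (\<alpha>s ! j) (\<alpha>s ! Suc j)))"

text \<open>
  \<open>cancel_from l Ss\<close> is the concatenation of the subcircuits \<open>Ss\<close> after every sequence \<open>\<gamma>\<^sup>R \<gamma>\<close> between
  consecutive middle gates has been removed; the first \<open>l\<close> gates of the first subcircuit have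
  been cancelled against the subcircuit preceding it.
\<close>

fun cancel_from :: "nat \<Rightarrow> (gate list \<times> gate) list \<Rightarrow> gate list" where
  "cancel_from l [] = []"
| "cancel_from l [(\<alpha>, \<beta>)] = drop l \<alpha> @ [\<beta>] @ rev \<alpha>"
| "cancel_from l ((\<alpha>, \<beta>) # (\<alpha>', \<beta>') # Ss) =
     (let k = length (overlap \<alpha> \<alpha>')
      in drop l \<alpha> @ [\<beta>] @ rev (drop k \<alpha>) @ cancel_from k ((\<alpha>', \<beta>') # Ss))"

definition cancelled_circuit :: "(gate list \<times> gate) list \<Rightarrow> gate list" where
  "cancelled_circuit Ss = cancel_from 0 Ss"

definition cnot_count :: "gate list \<Rightarrow> nat" where
  "cnot_count C = length (filter is_CNOT C)"

lemma cnot_count_circuit: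
  assumes "\<And>\<alpha> \<beta>. (\<alpha>, \<beta>) \<in> set Ss \<Longrightarrow> list_all is_CNOT \<alpha>"
  shows "cnot_count (circuit Ss) = cnot_count (cancelled_circuit Ss) +
    2 * (\<Sum>j<length Ss - 1. length (overlap (fst (Ss ! j)) (fst (Ss ! Suc j))))"
proof -
  have "cnot_count (circuit Ss) = cnot_count (cancel_from l Ss) + l +
      2 * (\<Sum>j<length Ss - 1. length (overlap (fst (Ss ! j)) (fst (Ss ! Suc j))))"
    if "\<And>\<alpha> \<beta>. (\<alpha>, \<beta>) \<in> set Ss \<Longrightarrow> list_all is_CNOT \<alpha>"
      and "Ss = [] \<longrightarrow> l = 0" and "Ss \<noteq> [] \<longrightarrow> l \<le> length (fst (hd Ss))" for l
    using that
  proof (induction l Ss rule: cancel_from.induct)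
    case (1 l)
    then show ?case by (simp add: circuit_def)
  next
    case (2 l \<alpha> \<beta>)
    have "filter is_CNOT (drop k \<alpha>) = drop k \<alpha>" for k
      using 2(1)[of \<alpha> \<beta>] by (auto simp: list_all_iff intro!: filter_True dest: in_set_dropD)
    from this[of l] this[of 0] 2(3) show ?case
      by (simp add: circuit_def cnot_count_def flip: rev_filter)
  next
    case (3 l \<alpha> \<beta> \<alpha>' \<beta>' Ss)
    let ?k = "length (overlap \<alpha> \<alpha>')"
    have k: "?k \<le> length \<alpha>" "?k \<le> length \<alpha>'"
      by (simp_all add: overlap_eq_Longest_common_prefix prefix_length_le
          Longest_common_prefix_prefix)
    have f: "filter is_CNOT (drop i \<alpha>) = drop i \<alpha>" for i
      using 3(2)[of \<alpha> \<beta>] by (auto simp: list_all_iff intro!: filter_True dest: in_set_dropD)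
    have "cnot_count (circuit ((\<alpha>', \<beta>') # Ss)) =
        cnot_count (cancel_from ?k ((\<alpha>', \<beta>') # Ss)) + ?k +
        2 * (\<Sum>j<length ((\<alpha>', \<beta>') # Ss) - 1.
          length (overlap (fst (((\<alpha>', \<beta>') # Ss) ! j)) (fst (((\<alpha>', \<beta>') # Ss) ! Suc j))))"
      using k 3(2) by (intro 3(1)) auto
    then show ?case
      using f[of l] f[of 0] f[of ?k] k 3(4)
      by (simp add: circuit_def cnot_count_def Let_def sum.lessThan_Suc_shift
          del: sum.lessThan_Suc flip: rev_filter)
  qed
  from this[of 0] assms show ?thesis
    by (simp add: cancelled_circuit_def)
qed

text \<open>The circuits, after cancellation of the overlaps, generated from \<open>U\<close> and the ordering \<open>ps\<close>.\<close>

definition optimized_circuits :: "nat \<Rightarrow> complex mat \<Rightarrow> (nat \<times> nat) list \<Rightarrow> gate list set" where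
  "optimized_circuits n U ps =
     {cancelled_circuit (subcircuits n ps Vs) | Vs. two_level_decomposition n U ps Vs}"

end

theory Submission
  imports Defs
begin

text \<open>
  The half palindrome of \<open>(r, c)\<close> is determined by \<open>c\<close> and the increasing list of bits in which \<open>c\<close>
  and \<open>r\<close> differ, without its last element. Hence, within a column, the overlap of two
  subcircuits is the length of the longest common prefix of these lists, and splitting the rows by
  their least significant bit reduces column \<open>c\<close> for \<open>n + 1\<close> bits to two copies of column \<open>c div 2\<close>
  for \<open>n\<close> bits, with no overlap across the two parts. This is the recursion that defines
  \<open>R\<^sub>m\<^sup>c\<close>. Between columns \<open>c\<close> and \<open>c + 1\<close> at most one gate can overlap, and only if \<open>c\<close> is even;
  the recursion attains this bound, because its columns end in odd and start with even rows
  there.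

  A two-level decomposition exists by Givens rotations: their phases can be chosen so that the
  eliminated matrix is upper triangular with nonnegative diagonal, and a unitary matrix of that
  form is the identity.
\<close>

section \<open>Sums over adjacent list elements\<close>

text \<open>The indexed sum in \<open>total_overlap\<close> in a recursive form that splits along
  appends and filters; \<open>adj_sum_conv_nth\<close> links the two.\<close>

fun adj_sum :: "('a \<Rightarrow> 'a \<Rightarrow> nat) \<Rightarrow> 'a list \<Rightarrow> nat" where
  "adj_sum f [] = 0"
| "adj_sum f [x] = 0"
| "adj_sum f (x # y # zs) = f x y + adj_sum f (y # zs)"

lemma adj_sum_Cons: "adj_sum f (x # xs) = (if xs = [] then 0 else f x (hd xs)) + adj_sum f xs"
  by (cases xs) auto

lemma adj_sum_append:
  "adj_sum f (xs @ ys) =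
    adj_sum f xs + (if xs = [] \<or> ys = [] then 0 else f (last xs) (hd ys)) + adj_sum f ys"
  by (induction xs) (auto simp: adj_sum_Cons)

lemma adj_sum_map: "adj_sum f (map g xs) = adj_sum (\<lambda>x y. f (g x) (g y)) xs"
  by (induction xs) (auto simp: adj_sum_Cons hd_map)

lemma adj_sum_cong:
  assumes "\<And>x y. x \<in> set xs \<Longrightarrow> y \<in> set xs \<Longrightarrow> f x y = g x y"
  shows "adj_sum f xs = adj_sum g xs"
  using assms by (induction xs) (auto simp: adj_sum_Cons)

lemma adj_sum_eq_0:
  assumes "distinct xs"
    and "\<And>x y. x \<in> set xs \<Longrightarrow> y \<in> set xs \<Longrightarrow> x \<noteq> y \<Longrightarrow> f x y = 0"
  shows "adj_sum f xs = 0"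
  using assms
proof (induction xs)
  case (Cons x xs)
  have "f x (hd xs) = 0" if "xs \<noteq> []"
    using Cons.prems that by (metis distinct.simps(2) hd_in_set list.set_intros)
  then show ?case using Cons by (simp add: adj_sum_Cons)
qed simp

lemma adj_sum_add_const: "adj_sum (\<lambda>x y. f x y + k) xs = adj_sum f xs + k * (length xs - 1)"
proof (induction xs)
  case (Cons x xs)
  then show ?case by (cases xs) auto
qed simp

lemma adj_sum_conv_nth: "adj_sum f xs = (\<Sum>j<length xs - 1. f (xs ! j) (xs ! Suc j))"
proof (induction xs)
  case (Cons x xs)
  then show ?case
    by (cases xs) (auto simp: sum.lessThan_Suc_shift simp del: sum.lessThan_Suc)
qed simp

text \<open>Only an inequality: if \<open>hd xs\<close> is filtered out, \<open>x\<close> may get a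
  new right neighbour, whose contribution is discarded.\<close>

lemma adj_sum_filter_Cons_ge:
  "adj_sum f (filter P (x # xs)) \<ge> (if P x \<and> xs \<noteq> [] \<and> P (hd xs) then f x (hd xs) else 0) +
    adj_sum f (filter P xs)"
  by (cases xs) (auto simp: adj_sum_Cons)

text \<open>A pair that is adjacent in \<open>xs\<close> and lies in one block is still adjacent after filtering.\<close>

lemma adj_sum_le_filter:
  assumes "\<And>x y. x \<in> set xs \<Longrightarrow> y \<in> set xs \<Longrightarrow> P x \<noteq> P y \<Longrightarrow> f x y = 0"
  shows "adj_sum f xs \<le> adj_sum f (filter P xs) + adj_sum f (filter (\<lambda>x. \<not> P x) xs)"
  using assms
proof (induction xs)
  case (Cons x xs)
  have "adj_sum f xs \<le> adj_sum f (filter P xs) + adj_sum f (filter (\<lambda>x. \<not> P x) xs)"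
    using Cons by auto
  moreover have "f x (hd xs) = 0" if "xs \<noteq> []" "P x \<noteq> P (hd xs)"
    using Cons(2)[of x "hd xs"] that by auto
  ultimately show ?case
    using adj_sum_filter_Cons_ge[where f = f and P = P and x = x and xs = xs]
      adj_sum_filter_Cons_ge[where f = f and P = "\<lambda>x. \<not> P x" and x = x and xs = xs]
    unfolding adj_sum_Cons by (auto split: if_splits simp del: filter.simps)
qed simp

text \<open>The sum over a concatenation of nonempty blocks consists of the sums inside the blocks
  and one term per seam, so two such lists can be compared block by block and seam by seam.\<close>

lemma adj_sum_concat_le:
  assumes "\<And>c. c < k \<Longrightarrow> A c \<noteq> []" "\<And>c. c < k \<Longrightarrow> B c \<noteq> []"
    and "\<And>c. c < k \<Longrightarrow> adj_sum f (A c) \<le> adj_sum f (B c)"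
    and "\<And>c. Suc c < k \<Longrightarrow> f (last (A c)) (hd (A (Suc c))) \<le> f (last (B c)) (hd (B (Suc c)))"
  shows "adj_sum f (concat (map A [0..<k])) \<le> adj_sum f (concat (map B [0..<k]))"
  using assms
proof (induction k)
  case (Suc k)
  have IH: "adj_sum f (concat (map A [0..<k])) \<le> adj_sum f (concat (map B [0..<k]))"
    using Suc by auto
  show ?case
  proof (cases k)
    case 0
    then show ?thesis using Suc.prems by simp
  next
    case k: (Suc j)
    have last: "last (concat (map C [0..<k])) = last (C j)" "concat (map C [0..<k]) \<noteq> []"
      if "C j \<noteq> []" for C :: "nat \<Rightarrow> 'a list"
      using that k by simp_all
    have ne: "A j \<noteq> []" "B j \<noteq> []" "A k \<noteq> []" "B k \<noteq> []"
      using Suc.prems k by auto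
    have "adj_sum f (concat (map C [0..<Suc k])) =
        adj_sum f (concat (map C [0..<k])) + f (last (C j)) (hd (C k)) + adj_sum f (C k)"
      if "C j \<noteq> []" "C k \<noteq> []" for C
      using last[of C] that by (simp add: adj_sum_append del: concat_eq_Nil_conv)
    moreover have "f (last (A j)) (hd (A k)) \<le> f (last (B j)) (hd (B k))"
      using Suc.prems(4)[of j] k by simp
    moreover have "adj_sum f (A k) \<le> adj_sum f (B k)" using Suc.prems by simp
    ultimately show ?thesis using IH ne by simp
  qed
qed simp

lemma sorted_split:
  assumes "sorted (map f xs)"
  shows "filter (\<lambda>x. f x < k) xs @ filter (\<lambda>x. k \<le> f x) xs = xs"
  using assms
proof (induction xs)
  case (Cons x xs)
  show ?case
  proof (cases "f x < k")
    case True
    then show ?thesis using Cons by simp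
  next
    case False
    then have "\<forall>y\<in>set xs. k \<le> f y" using Cons by auto
    then have "filter (\<lambda>x. f x < k) xs = []" "filter (\<lambda>x. k \<le> f x) xs = xs"
      by (auto simp: filter_empty_conv)
    then show ?thesis using False by simp
  qed
qed simp

text \<open>With \<open>f = snd\<close> this cuts a fixed-column ordering into its columns.\<close>

lemma sorted_eq_concat_filter:
  fixes f :: "'a \<Rightarrow> nat"
  assumes "sorted (map f xs)"
  shows "concat (map (\<lambda>c. filter (\<lambda>x. f x = c) xs) [0..<k]) = filter (\<lambda>x. f x < k) xs"
proof (induction k)
  case (Suc k)
  have "sorted (map f (filter (\<lambda>x. f x < Suc k) xs))"
    using assms by (simp add: sorted_filter)
  from sorted_split[OF this, of k]
  have "filter (\<lambda>x. f x < Suc k) xs = filter (\<lambda>x. f x < k) xs @ filter (\<lambda>x. f x = k) xs"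
    by (simp add: less_Suc_eq conj_disj_distribL conj_disj_distribR flip: eq_iff cong: conj_cong)
  then show ?case using Suc by simp
qed simp

section \<open>Longest common prefixes\<close>

text \<open>A recursive length of the longest common prefix, to replace the \<open>ARG_MAX\<close>
  in \<open>overlap\<close> by something suited to induction.\<close>

fun lcp :: "'a list \<Rightarrow> 'a list \<Rightarrow> nat" where
  "lcp (x # xs) (y # ys) = (if x = y then Suc (lcp xs ys) else 0)"
| "lcp _ _ = 0"

lemma lcp_Nil [simp]: "lcp xs [] = 0"
  by (cases xs) auto

lemma length_overlap: "length (overlap xs ys) = lcp xs ys"
  unfolding overlap_eq_Longest_common_prefix
proof (induction xs ys rule: lcp.induct)
  case (1 x xs y ys)
  show ?case
  proof (cases "x = y")
    case True
    have "{x # xs, x # ys} = (#) x ` {xs, ys}" by auto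
    then show ?thesis
      using 1 True Longest_common_prefix_image_Cons[of "{xs, ys}" x] by simp
  next
    case False
    then show ?thesis using Longest_common_prefix_eq_Nil[of x xs "{x # xs, y # ys}" y ys] by simp
  qed
qed (simp_all add: Longest_common_prefix_Nil)

lemma lcp_map: "inj f \<Longrightarrow> lcp (map f xs) (map f ys) = lcp xs ys"
  by (induction xs ys rule: lcp.induct) (auto dest: injD)

section \<open>Gray codes as lists of differing bits\<close>

text \<open>For \<open>c\<close>, \<open>r\<close> below \<open>2 ^ n\<close> these are the bits
  flipped by the Gray code from \<open>c\<close> to \<open>r\<close>, in the order of
  flipping.\<close>

definition diff_bits :: "nat \<Rightarrow> nat \<Rightarrow> nat \<Rightarrow> nat list" where
  "diff_bits n c r = filter (\<lambda>k. bit c k \<noteq> bit r k) [0..<n]"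

text \<open>Separates the starting word from the targets: inside a column the gates depend on the
  row only through the list of targets.\<close>

fun gates :: "nat \<Rightarrow> nat \<Rightarrow> nat list \<Rightarrow> gate list" where
  "gates n c [] = []"
| "gates n c (t # ts) = CNOT t (controls n t c) # gates n (flip_bit t c) ts"

text \<open>From a common starting word, equal targets give equal gates and lead to the same next
  word, while different targets already distinguish the gates.\<close>

lemma lcp_gates: "lcp (gates n c xs) (gates n c ys) = lcp xs ys"
  by (induction xs ys arbitrary: c rule: lcp.induct) auto

lemma gray_code_self [simp]: "gray_code c c = [c]"
  by (simp add: gray_code.simps[of c c])

lemma gray_code_step: "c \<noteq> r \<Longrightarrow> gray_code c r = c # gray_code (flip_bit (lowest_diff c r) c) r"
  by (simp add: gray_code.simps[of c r])

lemma hd_gray_code: "gray_code c r ! 0 = c"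
  by (subst gray_code.simps) simp

lemma gray_code_not_Nil [simp]: "gray_code c r \<noteq> []"
  by (subst gray_code.simps) simp

lemma lowest_diff_flip_bit: "lowest_diff c (flip_bit t c) = t"
  unfolding lowest_diff_def by (rule Least_equality) (auto simp: bit_simps split: if_splits)

lemma palindrome_half_self [simp]: "palindrome_half n c c = []"
  by (simp add: palindrome_half_def Let_def)

text \<open>When one flip reaches \<open>r\<close>, that flip is the last edge of the Gray code. It
  belongs to the middle gate, so no gate is emitted.\<close>

lemma palindrome_half_step:
  assumes "c \<noteq> r"
  defines "t \<equiv> lowest_diff c r"
  shows "palindrome_half n c r =
    (if flip_bit t c = r then [] else CNOT t (controls n t c) # palindrome_half n (flip_bit t c) r)"
proof -
  have gc: "gray_code c r = c # gray_code (flip_bit t c) r"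
    using assms gray_code_step by simp
  show ?thesis
  proof (cases "flip_bit t c = r")
    case True
    then show ?thesis by (simp add: palindrome_half_def gc)
  next
    case False
    obtain g where g: "gray_code (flip_bit t c) r = flip_bit t c # g" "g \<noteq> []"
      using gray_code_step[OF False] by simp
    \<comment> \<open>At least two words remain after the first one, so the subtraction of 2 does
      not truncate.\<close>
    have l: "length (gray_code c r) - 2 = Suc (length (gray_code (flip_bit t c) r) - 2)"
      using g by (cases g) (simp_all add: gc)
    show ?thesis
      using False
      unfolding palindrome_half_def Let_def l upt_conv_Cons[OF zero_less_Suc]
      by (simp add: gc hd_gray_code lowest_diff_flip_bit map_Suc_upt[symmetric] o_def del: upt_Suc)
  qed
qed

lemma diff_bits_eq_Nil:
  assumes "\<And>k. n \<le> k \<Longrightarrow> bit c k = bit r k"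
  shows "diff_bits n c r = [] \<longleftrightarrow> c = r"
  using assms by (fastforce simp: diff_bits_def filter_empty_conv bit_eq_iff not_less)

text \<open>Below \<open>t\<close> the two words agree and above \<open>t\<close> the flip changes
  nothing, so exactly the head of the list disappears. This is the recursion of
  \<open>gray_code\<close>.\<close>

lemma diff_bits_step:
  assumes "\<And>k. n \<le> k \<Longrightarrow> bit c k = bit r k" "c \<noteq> r"
  defines "t \<equiv> lowest_diff c r"
  shows "diff_bits n c r = t # diff_bits n (flip_bit t c) r" and "t < n"
proof -
  have ex: "\<exists>k. bit c k \<noteq> bit r k" using assms by (auto simp: bit_eq_iff)
  have t: "bit c t \<noteq> bit r t"
    unfolding t_def lowest_diff_def using ex by (rule LeastI_ex)
  have less: "bit c k = bit r k" if "k < t" for k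
    using not_less_Least[of k "\<lambda>k. bit c k \<noteq> bit r k"] that unfolding t_def lowest_diff_def by simp
  show "t < n" using t assms(1) not_less by blast
  then have "[0..<n] = [0..<t] @ t # [Suc t..<n]"
    using upt_add_eq_append[of 0 t "n - t"] by (simp add: upt_conv_Cons)
  moreover have "filter (\<lambda>k. bit c k \<noteq> bit r k) [0..<t] = []"
    "filter (\<lambda>k. bit (flip_bit t c) k \<noteq> bit r k) [0..<t] = []"
    using less by (auto simp: filter_empty_conv bit_simps)
  moreover have "filter (\<lambda>k. bit (flip_bit t c) k \<noteq> bit r k) [Suc t..<n] =
      filter (\<lambda>k. bit c k \<noteq> bit r k) [Suc t..<n]"
    by (rule filter_cong) (auto simp: bit_simps)
  ultimately show "diff_bits n c r = t # diff_bits n (flip_bit t c) r"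
    using t by (simp add: diff_bits_def bit_simps)
qed

text \<open>For \<open>c \<noteq> r\<close>, \<open>butlast\<close> removes the most significant
  differing bit, the target of the middle gate. The hypothesis is phrased by bits because it then
  passes directly to the flipped word in the induction.\<close>

lemma palindrome_half_eq_gates:
  assumes "\<And>k. n \<le> k \<Longrightarrow> bit c k = bit r k"
  shows "palindrome_half n c r = gates n c (butlast (diff_bits n c r))"
  using assms
proof (induction c r rule: gray_code.induct)
  case (1 c r)
  show ?case
  proof (cases "c = r")
    case True
    then show ?thesis using diff_bits_eq_Nil[OF "1.prems"] by simp
  next
    case False
    let ?t = "lowest_diff c r"
    have agree: "bit (flip_bit ?t c) k = bit r k" if "n \<le> k" for k
    proof -
      have "?t < n" using "1.prems" False by (rule diff_bits_step(2))
      then show ?thesis using "1.prems"[OF that] that by (auto simp: bit_simps)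
    qed
    show ?thesis
      using "1.IH"[OF False agree] diff_bits_step(1)[OF "1.prems" False]
        diff_bits_eq_Nil[OF agree]
      by (simp add: palindrome_half_step[OF False])
  qed
qed

lemma not_bit_of_less: "c < 2 ^ n \<Longrightarrow> n \<le> k \<Longrightarrow> \<not> bit (c :: nat) k"
  by (metis bit_take_bit_iff not_less take_bit_nat_eq_self_iff)

lemma palindrome_half_eq:
  "c < 2 ^ n \<Longrightarrow> r < 2 ^ n \<Longrightarrow> palindrome_half n c r = gates n c (butlast (diff_bits n c r))"
  by (rule palindrome_half_eq_gates) (simp add: not_bit_of_less)

section \<open>Overlaps within a column: recursion on the least significant bit\<close>

lemma diff_bits_Suc:
  "diff_bits (Suc n) (2 * c + of_bool a) (2 * r + of_bool b) =
    (if a \<noteq> b then [0] else []) @ map Suc (diff_bits n c r)"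
  unfolding diff_bits_def upt_conv_Cons[OF zero_less_Suc] map_Suc_upt[symmetric]
  by (auto simp: filter_map o_def bit_0 bit_Suc simp del: upt_Suc)

text \<open>The overlap of two rows of column \<open>c\<close>, with the gates reduced to their
  targets as \<open>palindrome_half_eq\<close> and \<open>lcp_gates\<close> permit.\<close>

definition col_overlap :: "nat \<Rightarrow> nat \<Rightarrow> nat \<Rightarrow> nat \<Rightarrow> nat" where
  "col_overlap n c r r' = lcp (butlast (diff_bits n c r)) (butlast (diff_bits n c r'))"

lemma diff_bits_neq_Nil: "c < 2 ^ n \<Longrightarrow> r < 2 ^ n \<Longrightarrow> c \<noteq> r \<Longrightarrow> diff_bits n c r \<noteq> []"
  by (subst diff_bits_eq_Nil) (simp_all add: not_bit_of_less)

lemma diff_bits_self [simp]: "diff_bits n c c = []"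
  by (simp add: diff_bits_def)

text \<open>Since \<open>c \<noteq> r\<close>, the element dropped by \<open>butlast\<close> comes
  from the shifted part, and a leading 0 survives.\<close>

lemma butlast_diff_bits_Suc:
  assumes "c < 2 ^ n" "r < 2 ^ n" "c \<noteq> r"
  shows "butlast (diff_bits (Suc n) (2 * c + of_bool a) (2 * r + of_bool b)) =
    (if a \<noteq> b then [0] else []) @ map Suc (butlast (diff_bits n c r))"
  using diff_bits_neq_Nil[OF assms] unfolding diff_bits_Suc by (simp add: butlast_append map_butlast)

text \<open>If the parity of the rows differs from that of the column, both lists begin with bit 0,
  which is one more common gate.\<close>

lemma col_overlap_same_parity:
  assumes "c < 2 ^ n" "x < 2 ^ n" "y < 2 ^ n" "x \<noteq> c" "y \<noteq> c"
  shows "col_overlap (Suc n) (2 * c + of_bool a) (2 * x + of_bool b) (2 * y + of_bool b) =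
    col_overlap n c x y + of_bool (a \<noteq> b)"
  using assms by (simp add: col_overlap_def butlast_diff_bits_Suc lcp_map)

lemma lcp_map_Suc_0 [simp]: "lcp (map Suc xs) (0 # ys) = 0" "lcp (0 # ys) (map Suc xs) = 0"
  by (cases xs; simp)+

lemma lcp_butlast_map_Suc:
  "lcp (butlast (map Suc xs)) (butlast (0 # ys)) = 0" "lcp (butlast (0 # ys)) (butlast (map Suc xs)) = 0"
  by (simp_all add: map_butlast[symmetric])

text \<open>Exactly one of the two rows differs from the column in bit 0, so the two target lists
  cannot start with the same element.\<close>

lemma col_overlap_parity_neq:
  assumes "even x \<noteq> even y"
  shows "col_overlap (Suc n) c x y = 0"
proof -
  have "z = 2 * (z div 2) + of_bool (odd z)" for z :: nat
    by (simp add: mod_2_eq_odd[symmetric])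
  then obtain a b b' c' x' y' where *: "c = 2 * c' + of_bool a" "x = 2 * x' + of_bool b"
      "y = 2 * y' + of_bool b'"
    by metis
  with assms have "b \<noteq> b'" by auto
  then show ?thesis
    unfolding * col_overlap_def diff_bits_Suc
    by (cases a; cases b; cases b') (simp_all add: lcp_butlast_map_Suc del: butlast.simps)
qed

text \<open>Row \<open>2 * q + 1\<close> differs from column \<open>2 * q\<close> in bit 0 only. Its
  subcircuit is a bare middle gate, which overlaps with nothing.\<close>

lemma butlast_diff_bits_succ: "butlast (diff_bits (Suc n) (2 * q + of_bool a) (2 * q + 1)) = []"
  using diff_bits_Suc[of n q a q True] by simp

section \<open>The rows of the algorithm and their optimality within a column\<close>

lemma poa_rows_even: "2 \<le> m \<Longrightarrow> poa_rows (Suc m) (2 * q) =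
    map (\<lambda>x. 2 * x) (poa_rows m q) @ [2 * q + 1] @ map (\<lambda>x. 2 * x + 1) (poa_rows m q)"
  by (cases m; cases "m - 1") (auto simp: Let_def)

lemma poa_rows_odd: "2 \<le> m \<Longrightarrow> poa_rows (Suc m) (2 * q + 1) =
    map (\<lambda>x. 2 * x) (poa_rows m q) @ map (\<lambda>x. 2 * x + 1) (poa_rows m q)"
  by (cases m; cases "m - 1") (auto simp: Let_def)

text \<open>The rows of column \<open>2 * q\<close> are \<open>2 * q + 1\<close> and the numbers
  \<open>2 * x\<close>, \<open>2 * x + 1\<close> for the rows \<open>x\<close> of column
  \<open>q\<close>; column \<open>2 * q + 1\<close> has the latter only. Both cases match the
  recursion.\<close>

lemma set_poa_rows:
  assumes "2 \<le> n" "c < 2 ^ n"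
  shows "distinct (poa_rows n c) \<and> set (poa_rows n c) = {c<..<2 ^ n}"
  using assms
proof (induction n arbitrary: c rule: nat_induct_at_least)
  case base
  then have "c = 0 \<or> c = 1 \<or> c = 2 \<or> c = 3" by auto
  then show ?case by (auto simp: numeral_2_eq_2)
next
  case (Suc m)
  define q where "q = c div 2"
  have q: "q < 2 ^ m" using Suc.prems by (simp add: q_def less_mult_imp_div_less)
  note IH = Suc.IH[OF q]
  have mem: "r \<in> (\<lambda>x. 2 * x) ` A \<longleftrightarrow> even r \<and> r div 2 \<in> A"
    "r \<in> (\<lambda>x. 2 * x + 1) ` A \<longleftrightarrow> odd r \<and> r div 2 \<in> A" for r :: nat and A
    by (auto elim!: evenE oddE) presburger
  have inj: "distinct (map (\<lambda>x. 2 * x) xs) = distinct xs"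
    "distinct (map (\<lambda>x. 2 * x + 1) xs) = distinct xs" for xs :: "nat list"
    by (simp_all add: distinct_map inj_on_def)
  show ?case
  proof (cases "even c")
    case True
    then have c: "c = 2 * q" by (simp add: q_def)
    have "r \<in> set (poa_rows (Suc m) c) \<longleftrightarrow> r \<in> {c<..<2 ^ Suc m}" for r
      unfolding c poa_rows_even[OF Suc.hyps] set_append set_map mem Un_iff using IH q
      by (cases "even r") (auto elim!: evenE oddE)
    moreover have "distinct (poa_rows (Suc m) c)"
      unfolding c poa_rows_even[OF Suc.hyps] using IH
      by (auto simp: inj simp del: One_nat_def) presburger+
    ultimately show ?thesis by blast
  next
    case False
    then have c: "c = 2 * q + 1" by (simp add: q_def)
    have "r \<in> set (poa_rows (Suc m) c) \<longleftrightarrow> r \<in> {c<..<2 ^ Suc m}" for r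
      unfolding c poa_rows_odd[OF Suc.hyps] set_append set_map mem Un_iff using IH q
      by (cases "even r") (auto elim!: evenE oddE)
    moreover have "distinct (poa_rows (Suc m) c)"
      unfolding c poa_rows_odd[OF Suc.hyps] using IH
      by (auto simp: inj simp del: One_nat_def) presburger+
    ultimately show ?thesis by blast
  qed
qed

text \<open>With two bits, only the row that differs from \<open>c\<close> in both bits has any
  target left after \<open>butlast\<close>, so two distinct rows share none.\<close>

lemma col_overlap_2:
  assumes "c < 4" "x < 4" "y < 4" "x \<noteq> y"
  shows "col_overlap 2 c x y = 0"
proof -
  have "c = 0 \<or> c = 1 \<or> c = 2 \<or> c = 3" "x = 0 \<or> x = 1 \<or> x = 2 \<or> x = 3"
    "y = 0 \<or> y = 1 \<or> y = 2 \<or> y = 3" using assms by auto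
  moreover have "[0..<2] = [0, 1::nat]" by (simp add: numeral_2_eq_2)
  ultimately show ?thesis
    using \<open>x \<noteq> y\<close> unfolding col_overlap_def diff_bits_def
    by (elim disjE) (simp_all add: bit_0 bit_1_iff flip: numeral_2_eq_2)
qed

text \<open>Passing to one more bit changes every adjacent overlap in a block by the same constant,
  so the total changes by an amount that does not depend on the order of the rows.\<close>

lemma adj_sum_col_overlap_block:
  assumes "c < 2 ^ n" "set zs \<subseteq> {c<..<2 ^ n}"
  shows "adj_sum (col_overlap (Suc n) (2 * c + of_bool a)) (map (\<lambda>x. 2 * x + of_bool b) zs) =
    adj_sum (col_overlap n c) zs + of_bool (a \<noteq> b) * (length zs - 1)"
proof -
  have "adj_sum (col_overlap (Suc n) (2 * c + of_bool a)) (map (\<lambda>x. 2 * x + of_bool b) zs) =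
      adj_sum (\<lambda>x y. col_overlap n c x y + of_bool (a \<noteq> b)) zs"
    unfolding adj_sum_map using assms
    by (intro adj_sum_cong col_overlap_same_parity) auto
  then show ?thesis by (simp add: adj_sum_add_const)
qed

text \<open>Supplies the orderings of column \<open>q\<close> to which the induction hypothesis is
  applied.\<close>

lemma half_rows:
  fixes c q :: nat
  assumes "distinct ys" "set ys = {c<..<2 * N}" "c = 2 * q + of_bool a"
  obtains zs where "filter (\<lambda>r. odd r = b \<and> r \<noteq> 2 * q + 1) ys = map (\<lambda>x. 2 * x + of_bool b) zs"
    and "distinct zs" and "set zs = {q<..<N}"
proof -
  define F where "F = filter (\<lambda>r. odd r = b \<and> r \<noteq> 2 * q + 1) ys"
  define zs where "zs = map (\<lambda>r. r div 2) F"
  have "2 * (r div 2) + of_bool b = r" if "r \<in> set F" for r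
    using that by (auto simp: F_def mod_2_eq_odd[symmetric])
  then have F: "F = map (\<lambda>x. 2 * x + of_bool b) zs"
    by (simp add: zs_def map_idI o_def)
  moreover have "distinct F" using assms by (simp add: F_def)
  then have "distinct zs" unfolding F by (simp add: distinct_map)
  moreover have "x \<in> set zs \<longleftrightarrow> 2 * x + of_bool b \<in> set F" for x
    unfolding F by auto
  then have "set zs = {q<..<N}"
    using assms by (cases a; cases b) (auto simp: F_def)
  ultimately show ?thesis using that[of zs] unfolding F_def by blast
qed

text \<open>Rows of different parity do not overlap, so an ordering does no better than its even and
  odd parts separately. Up to the row \<open>2 * q + 1\<close>, each part is a doubled ordering of
  column \<open>q\<close>, bounded by induction, and the recursion juxtaposes two optimal
  parts.\<close>

lemma adj_sum_col_overlap_le_poa_rows: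
  assumes "2 \<le> n" "c < 2 ^ n" "distinct ys" "set ys = {c<..<2 ^ n}"
  shows "adj_sum (col_overlap n c) ys \<le> adj_sum (col_overlap n c) (poa_rows n c)"
  using assms
proof (induction n arbitrary: c ys rule: nat_induct_at_least)
  case base
  then have "adj_sum (col_overlap 2 c) ys = 0"
    by (intro adj_sum_eq_0 col_overlap_2) auto
  then show ?case by simp
next
  case (Suc m)
  define q where "q = c div 2"
  define a where "a = odd c"
  have q: "q < 2 ^ m" using Suc.prems by (simp add: q_def less_mult_imp_div_less)
  have c: "c = 2 * q + of_bool a" by (simp add: q_def a_def mod_2_eq_odd[symmetric])
  let ?f = "col_overlap (Suc m) c"
  let ?R = "poa_rows m q"
  let ?k = "adj_sum (col_overlap m q) ?R"
  note R = set_poa_rows[OF Suc.hyps q]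
  have part: "adj_sum ?f (filter (\<lambda>r. odd r = b \<and> r \<noteq> 2 * q + 1) ys) \<le>
      adj_sum ?f (map (\<lambda>x. 2 * x + of_bool b) ?R)" for b
  proof -
    obtain zs where zs: "filter (\<lambda>r. odd r = b \<and> r \<noteq> 2 * q + 1) ys = map (\<lambda>x. 2 * x + of_bool b) zs"
      "distinct zs" "set zs = {q<..<2 ^ m}"
      using half_rows[OF Suc.prems(2), of c "2 ^ m" q a] Suc.prems c by auto
    have "length zs = length ?R" using zs R by (metis distinct_card)
    then show ?thesis
      unfolding zs(1) c using Suc.IH[OF q zs(2,3)] R q zs
      by (simp add: adj_sum_col_overlap_block)
  qed
  have z: "butlast (diff_bits (Suc m) c (2 * q + 1)) = []"
    unfolding c by (rule butlast_diff_bits_succ)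
  have "adj_sum ?f ys \<le> adj_sum ?f (filter even ys) + adj_sum ?f (filter odd ys)"
    by (intro adj_sum_le_filter col_overlap_parity_neq)
  moreover have "filter even ys = filter (\<lambda>r. odd r = False \<and> r \<noteq> 2 * q + 1) ys"
    by (rule filter_cong) auto
  \<comment> \<open>The same filtering lemma splits off row \<open>2 * q + 1\<close>, because by
    \<open>z\<close> its overlap with every row is 0.\<close>
  moreover have "adj_sum ?f (filter odd ys) \<le> adj_sum ?f (filter (\<lambda>r. r \<noteq> 2 * q + 1) (filter odd ys)) +
      adj_sum ?f (filter (\<lambda>r. \<not> r \<noteq> 2 * q + 1) (filter odd ys))"
    by (intro adj_sum_le_filter) (auto simp: col_overlap_def z simp del: One_nat_def)
  moreover have "adj_sum ?f (filter (\<lambda>r. \<not> r \<noteq> 2 * q + 1) (filter odd ys)) = 0"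
    using Suc.prems by (intro adj_sum_eq_0) auto
  moreover have "filter (\<lambda>r. r \<noteq> 2 * q + 1) (filter odd ys) = filter (\<lambda>r. odd r = True \<and> r \<noteq> 2 * q + 1) ys"
    by (simp add: conj_commute)
  ultimately have "adj_sum ?f ys \<le> adj_sum ?f (map (\<lambda>x. 2 * x) ?R) + adj_sum ?f (map (\<lambda>x. 2 * x + 1) ?R)"
    using part[of False] part[of True] by simp
  \<comment> \<open>The terms at the seams between the blocks are natural numbers, so leaving them
    out can only lower the sum.\<close>
  also have "\<dots> \<le> adj_sum ?f (poa_rows (Suc m) c)"
    using c poa_rows_even[OF Suc.hyps] poa_rows_odd[OF Suc.hyps]
    by (cases a) (simp_all add: adj_sum_append adj_sum_Cons)
  finally show ?case .
qed

section \<open>Overlaps between consecutive columns\<close>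

lemma bit_eq_of_controls_eq:
  assumes "controls n t c = controls n t c'" "k < n" "k \<noteq> t"
  shows "bit c k = bit c' k"
  using fun_cong[OF assms(1), of k] assms(2,3) by (simp add: controls_def)

text \<open>Equal first gates force \<open>c\<close> and \<open>c + 1\<close> to agree off the
  target. As bit 0 always differs, the target is 0 and \<open>c\<close> must be even. A second
  common gate is impossible: its target is positive, so bit 0 is a control, on which the two words
  still disagree.\<close>

lemma lcp_gates_Suc_le:
  assumes "Suc c < 2 ^ n" "sorted_wrt (<) xs"
  shows "lcp (gates n c xs) (gates n (Suc c) ys) \<le> of_bool (even c)"
proof (cases "\<exists>t xs' ys'. xs = t # xs' \<and> ys = t # ys' \<and> controls n t c = controls n t (Suc c)")
  case True
  then obtain t xs' ys' where *: "xs = t # xs'" "ys = t # ys'" "controls n t c = controls n t (Suc c)"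
    by auto
  have n: "0 < n" using assms(1) by (cases n) auto
  have t: "t = 0"
    using bit_eq_of_controls_eq[OF *(3) n] by (auto simp: bit_0)
  have "even c"
  proof (rule ccontr)
    assume "odd c"
    \<comment> \<open>The controls cover bits 1 to \<open>n - 1\<close>, and all higher bits vanish;
      so the halves would coincide, although for odd \<open>c\<close> they differ by one.\<close>
    have "bit (c div 2) k = bit (Suc c div 2) k" for k
      using bit_eq_of_controls_eq[OF *(3), of "Suc k"] not_bit_of_less[of c n "Suc k"]
        not_bit_of_less[of "Suc c" n "Suc k"] assms(1) t
      by (cases "Suc k < n") (auto simp: bit_Suc)
    then have "c div 2 = Suc c div 2" by (simp add: bit_eq_iff)
    with \<open>odd c\<close> show False by (auto elim!: oddE)
  qed
  moreover have "lcp (gates n (flip_bit t c) xs') (gates n (flip_bit t (Suc c)) ys') = 0"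
  proof -
    have False if "xs' = u # us" "controls n u (flip_bit t c) = controls n u (flip_bit t (Suc c))"
      for u us
    proof -
      have "u \<noteq> 0" using that(1) assms(2) *(1) t by auto
      then have "bit (flip_bit 0 c) 0 = bit (flip_bit 0 (Suc c)) 0"
        using bit_eq_of_controls_eq[OF that(2) n] t by blast
      then have "bit c 0 = bit (Suc c) 0" by (simp only: bit_flip_bit_iff) simp
      then show False by (simp add: bit_0)
    qed
    then show ?thesis by (cases xs'; cases ys') auto
  qed
  ultimately show ?thesis using * by simp
next
  case False
  then have "lcp (gates n c xs) (gates n (Suc c) ys) = 0"
    by (cases xs; cases ys) auto
  then show ?thesis by simp
qed

text \<open>At this seam both rows differ from their columns in bit 0, and because \<open>x\<close>
  and \<open>y\<close> exceed \<open>q\<close> also in a higher bit, so that the flip of bit 0 is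
  not the dropped last one.\<close>

lemma poa_rows_boundary:
  assumes "2 \<le> n" "Suc (2 * q) < 2 ^ n - 1"
  obtains x y where "last (poa_rows n (2 * q)) = 2 * x + 1" "q < x" "x < 2 ^ (n - 1)"
    "hd (poa_rows n (2 * q + 1)) = 2 * y" "q < y" "y < 2 ^ (n - 1)"
proof (cases "n = 2")
  case True
  then have "q = 0" using assms by simp
  \<comment> \<open>The columns are \<open>[1, 2, 3]\<close> and \<open>[2, 3]\<close>, meeting in 3
    and 2.\<close>
  then show ?thesis using that[of 1 1] True by (simp add: numeral_2_eq_2)
next
  case False
  define m where "m = n - 1"
  have m: "n = Suc m" "2 \<le> m" using False assms by (auto simp: m_def)
  have q: "Suc q < 2 ^ m" using assms m by simp
  have R: "set (poa_rows m q) = {q<..<2 ^ m}" using set_poa_rows[of m q] m q by auto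
  then have ne: "poa_rows m q \<noteq> []" using q by auto
  have "last (poa_rows m q) \<in> {q<..<2 ^ m}" "hd (poa_rows m q) \<in> {q<..<2 ^ m}"
    using R ne last_in_set hd_in_set by blast+
  then show ?thesis
    using that[of "last (poa_rows m q)" "hd (poa_rows m q)"] ne
    unfolding m(1) poa_rows_even[OF m(2)] poa_rows_odd[OF m(2)]
    by (simp add: last_map hd_map hd_append)
qed

definition pair_overlap :: "nat \<Rightarrow> nat \<times> nat \<Rightarrow> nat \<times> nat \<Rightarrow> nat" where
  "pair_overlap n = (\<lambda>(r, c) (r', c'). lcp (palindrome_half n c r) (palindrome_half n c' r'))"

lemma total_overlap_eq_adj_sum: "total_overlap n ps = adj_sum (pair_overlap n) ps"
  by (simp add: total_overlap_def adj_sum_conv_nth length_overlap pair_overlap_def Let_def case_prod_beta)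

lemma sorted_diff_bits: "sorted_wrt (<) (diff_bits n c r)"
  unfolding diff_bits_def by (intro sorted_wrt_filter) simp

lemma sorted_wrt_butlast: "sorted_wrt P xs \<Longrightarrow> sorted_wrt P (butlast xs)"
  by (simp add: butlast_conv_take sorted_wrt_take)

lemma pair_overlap_Suc_le:
  assumes "Suc c < 2 ^ n" "r < 2 ^ n" "r' < 2 ^ n"
  shows "pair_overlap n (r, c) (r', Suc c) \<le> of_bool (even c)"
  using assms
  by (simp add: pair_overlap_def palindrome_half_eq lcp_gates_Suc_le sorted_diff_bits sorted_wrt_butlast)

text \<open>For even \<open>c\<close> both target lists start with 0, and \<open>c\<close>,
  \<open>c + 1\<close> agree on all other bits, so the first gates coincide.\<close>

lemma pair_overlap_poa:
  assumes "2 \<le> n" "Suc c < 2 ^ n - 1"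
  shows "of_bool (even c) \<le> pair_overlap n (last (poa_rows n c), c) (hd (poa_rows n (Suc c)), Suc c)"
proof (cases "even c")
  case True
  then obtain q where q: "c = 2 * q" by auto
  from poa_rows_boundary[OF assms(1), of q] assms(2) q obtain x y where
    xy: "last (poa_rows n c) = 2 * x + 1" "q < x" "x < 2 ^ (n - 1)"
    "hd (poa_rows n (Suc c)) = 2 * y" "q < y" "y < 2 ^ (n - 1)"
    by auto
  obtain m where m: "n = Suc m" using assms by (cases n) auto
  have b: "butlast (diff_bits n (2 * q) (2 * x + 1)) = 0 # map Suc (butlast (diff_bits m q x))"
    "butlast (diff_bits n (Suc (2 * q)) (2 * y)) = 0 # map Suc (butlast (diff_bits m q y))"
    using butlast_diff_bits_Suc[of q m x False True] butlast_diff_bits_Suc[of q m y True False] xy m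
    by simp_all
  have "bit (2 * q) k = bit (Suc (2 * q)) k" if "k \<noteq> 0" for k
    using that by (cases k) (simp_all add: bit_Suc)
  then have "controls n 0 (2 * q) = controls n 0 (Suc (2 * q))"
    by (auto simp: controls_def)
  moreover have "2 * x + 1 < 2 ^ n" "2 * y < 2 ^ n" "2 * q < 2 ^ n" "Suc (2 * q) < 2 ^ n"
    using xy m assms q by simp_all
  ultimately show ?thesis
    using b by (simp add: pair_overlap_def xy[unfolded q] q palindrome_half_eq)
qed simp

section \<open>Optimality of the total overlap\<close>

text \<open>The only freedom in such an ordering is the order of the rows inside each column. The
  range stops before \<open>2 ^ n - 1\<close>, whose column has no rows.\<close>

lemma fixed_column_ordering_concat:
  assumes "fixed_column_ordering n ps"
  obtains Rs where "ps = concat (map (\<lambda>c. map (\<lambda>r. (r, c)) (Rs c)) [0..<2 ^ n - 1])"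
    and "\<And>c. distinct (Rs c)" and "\<And>c. set (Rs c) = {c<..<2 ^ n}"
proof
  let ?Rs = "\<lambda>c. map fst (filter (\<lambda>p. snd p = c) ps)"
  have ps: "distinct ps" "set ps = {(r, c). c < r \<and> r < 2 ^ n}" "sorted (map snd ps)"
    using assms by (simp_all add: fixed_column_ordering_def)
  have "map (\<lambda>r. (r, c)) (?Rs c) = filter (\<lambda>p. snd p = c) ps" for c
    by (auto simp: o_def intro!: map_idI)
  moreover have "filter (\<lambda>p. snd p < 2 ^ n - 1) ps = ps"
  proof (intro filter_True ballI)
    fix p assume "p \<in> set ps"
    then have "snd p < fst p" "fst p < 2 ^ n" unfolding ps(2) by auto
    then show "snd p < 2 ^ n - 1" by linarith
  qed
  ultimately show "ps = concat (map (\<lambda>c. map (\<lambda>r. (r, c)) (?Rs c)) [0..<2 ^ n - 1])"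
    using sorted_eq_concat_filter[OF ps(3), of "2 ^ n - 1"] by simp
  show "distinct (?Rs c)" for c
    using ps(1) by (auto simp: distinct_map inj_on_def)
  have "r \<in> set (?Rs c) \<longleftrightarrow> (r, c) \<in> set ps" for r c
    by force
  then show "set (?Rs c) = {c<..<2 ^ n}" for c
    by (simp only: set_eq_iff ps(2) greaterThanLessThan_iff mem_Collect_eq case_prod_conv simp_thms)
qed

lemma adj_sum_pair_overlap_column:
  assumes "c < 2 ^ n" "set rs \<subseteq> {c<..<2 ^ n}"
  shows "adj_sum (pair_overlap n) (map (\<lambda>r. (r, c)) rs) = adj_sum (col_overlap n c) rs"
  unfolding adj_sum_map using assms
  by (intro adj_sum_cong) (auto simp: pair_overlap_def col_overlap_def palindrome_half_eq lcp_gates subset_eq)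

lemma total_overlap_le_poa:
  assumes "2 \<le> n" "fixed_column_ordering n ps"
  shows "total_overlap n ps \<le> total_overlap n (poa_ordering n)"
proof -
  obtain Rs where Rs: "ps = concat (map (\<lambda>c. map (\<lambda>r. (r, c)) (Rs c)) [0..<2 ^ n - 1])"
    "\<And>c. distinct (Rs c)" "\<And>c. set (Rs c) = {c<..<2 ^ n}"
    using fixed_column_ordering_concat[OF assms(2)] by metis
  have P: "distinct (poa_rows n c)" "set (poa_rows n c) = {c<..<2 ^ n}" if "c < 2 ^ n - 1" for c
    using set_poa_rows[of n c] assms that by auto
  have ne: "{c<..<2 ^ n :: nat} \<noteq> {}" if "c < 2 ^ n - 1" for c
  proof -
    have "Suc c \<in> {c<..<2 ^ n}" using that by (simp add: less_diff_conv)
    then show ?thesis by blast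
  qed
  have Rs_ne: "Rs c \<noteq> []" if "c < 2 ^ n - 1" for c
    using Rs(3)[of c] ne[OF that] by (metis set_empty)
  have P_ne: "poa_rows n c \<noteq> []" if "c < 2 ^ n - 1" for c
    using P(2)[OF that] ne[OF that] by (metis set_empty)
  show ?thesis
    unfolding total_overlap_eq_adj_sum Rs(1) poa_ordering_def
  proof (rule adj_sum_concat_le)
    fix c :: nat assume c: "c < 2 ^ n - 1"
    show "map (\<lambda>r. (r, c)) (Rs c) \<noteq> []" "map (\<lambda>r. (r, c)) (poa_rows n c) \<noteq> []"
      using Rs_ne P_ne c by simp_all
    show "adj_sum (pair_overlap n) (map (\<lambda>r. (r, c)) (Rs c))
         \<le> adj_sum (pair_overlap n) (map (\<lambda>r. (r, c)) (poa_rows n c))"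
      using adj_sum_col_overlap_le_poa_rows[OF assms(1) _ Rs(2,3), of c] P c Rs(3)
      by (simp add: adj_sum_pair_overlap_column)
  next
    fix c :: nat assume c: "Suc c < 2 ^ n - 1"
    have "last (Rs c) \<in> {c<..<2 ^ n}" "hd (Rs (Suc c)) \<in> {Suc c<..<2 ^ n}"
      using Rs_ne[of c] Rs_ne[of "Suc c"] c Rs(3) last_in_set hd_in_set by (metis Suc_lessD)+
    then have "pair_overlap n (last (Rs c), c) (hd (Rs (Suc c)), Suc c) \<le> of_bool (even c)"
      using c by (intro pair_overlap_Suc_le) auto
    also note pair_overlap_poa[OF assms(1) c]
    finally show "pair_overlap n (last (map (\<lambda>r. (r, c)) (Rs c))) (hd (map (\<lambda>r. (r, Suc c)) (Rs (Suc c))))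
        \<le> pair_overlap n (last (map (\<lambda>r. (r, c)) (poa_rows n c)))
            (hd (map (\<lambda>r. (r, Suc c)) (poa_rows n (Suc c))))"
      using Rs_ne P_ne c by (simp add: last_map hd_map)
  qed
qed

lemma sorted_snd_concat_columns:
  "sorted (map snd (concat (map (\<lambda>c. map (\<lambda>r. (r, c)) (Rs c)) [0..<k])))"
proof (induction k)
  case (Suc k)
  have "sorted (map (\<lambda>r. k) (Rs k))" by (induction "Rs k") (auto simp: map_replicate_const)
  then show ?case using Suc by (auto simp: sorted_append o_def)
qed simp

lemma fixed_column_ordering_poa:
  assumes "2 \<le> n"
  shows "fixed_column_ordering n (poa_ordering n)"
proof -
  have P: "distinct (poa_rows n c)" "set (poa_rows n c) = {c<..<2 ^ n}" if "c < 2 ^ n - 1" for c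
    using set_poa_rows[of n c] assms that by auto
  have "distinct (concat (map (\<lambda>c. map (\<lambda>r. (r, c)) (poa_rows n c)) [0..<k]))" if "k \<le> 2 ^ n - 1" for k
    using that by (induction k) (auto simp: distinct_map inj_on_def P)
  moreover have "set (poa_ordering n) = {(r, c). c < r \<and> r < 2 ^ n}"
  proof -
    have "(r, c) \<in> set (poa_ordering n) \<longleftrightarrow> c < 2 ^ n - 1 \<and> r \<in> set (poa_rows n c)" for r c
      by (auto simp: poa_ordering_def)
    moreover have "c < 2 ^ n - 1 \<and> r \<in> set (poa_rows n c) \<longleftrightarrow> c < r \<and> r < 2 ^ n" for r c
      using P by (cases "c < 2 ^ n - 1") auto
    ultimately show ?thesis by (simp add: set_eq_iff)
  qed
  ultimately show ?thesis
    by (simp add: fixed_column_ordering_def poa_ordering_def sorted_snd_concat_columns)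
qed

section \<open>Existence of two-level decompositions\<close>

lemma mat_adjoint_carrier: "A \<in> carrier_mat N N \<Longrightarrow> mat_adjoint A \<in> carrier_mat N N"
  by (auto simp: mat_adjoint_def)

lemma index_mat_adjoint:
  "A \<in> carrier_mat N N \<Longrightarrow> i < N \<Longrightarrow> j < N \<Longrightarrow> mat_adjoint A $$ (i, j) = cnj (A $$ (j, i))"
  by (simp add: mat_adjoint_def mat_of_rows_index conjugate_complex_def)

lemma mat_adjoint_mat_adjoint:
  fixes A :: "complex mat"
  assumes "A \<in> carrier_mat N N"
  shows "mat_adjoint (mat_adjoint A) = A"
  using assms mat_adjoint_carrier[OF assms] mat_adjoint_carrier[OF mat_adjoint_carrier[OF assms]]
  by (intro eq_matI) (auto simp: index_mat_adjoint[of _ N])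

lemma index_mult_square:
  "A \<in> carrier_mat N N \<Longrightarrow> B \<in> carrier_mat N N \<Longrightarrow> i < N \<Longrightarrow> j < N \<Longrightarrow>
    (A * B) $$ (i, j) = (\<Sum>k<N. A $$ (i, k) * B $$ (k, j))"
  by (simp add: scalar_prod_def atLeast0LessThan)

lemma mat_adjoint_mult:
  fixes A B :: "complex mat"
  assumes "A \<in> carrier_mat N N" "B \<in> carrier_mat N N"
  shows "mat_adjoint (A * B) = mat_adjoint B * mat_adjoint A"
proof (rule eq_matI)
  have AB: "A * B \<in> carrier_mat N N" using assms by simp
  note carr = assms AB mat_adjoint_carrier[OF assms(1)] mat_adjoint_carrier[OF assms(2)] mat_adjoint_carrier[OF AB]
  fix i j assume "i < dim_row (mat_adjoint B * mat_adjoint A)" "j < dim_col (mat_adjoint B * mat_adjoint A)"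
  then have ij: "i < N" "j < N" using carr by auto
  then show "mat_adjoint (A * B) $$ (i, j) = (mat_adjoint B * mat_adjoint A) $$ (i, j)"
    using carr
    by (simp add: index_mat_adjoint[of _ N] index_mult_square[of _ N] mult.commute del: index_mult_mat)
qed (use assms in \<open>auto simp: mat_adjoint_def\<close>)

lemma unitary_matrix_carrier: "unitary_matrix N U \<Longrightarrow> U \<in> carrier_mat N N"
  by (simp add: unitary_matrix_def)

lemma unitary_matrix_adjoint: "unitary_matrix N U \<Longrightarrow> unitary_matrix N (mat_adjoint U)"
  by (auto simp: unitary_matrix_def mat_adjoint_mat_adjoint mat_adjoint_carrier)

text \<open>A right inverse of a square matrix is also a left inverse.\<close>

lemma unitary_matrixI:
  assumes "A \<in> carrier_mat N N" "A * mat_adjoint A = 1\<^sub>m N"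
  shows "unitary_matrix N A"
  using assms mat_mult_left_right_inverse[OF assms(1) mat_adjoint_carrier[OF assms(1)]]
  by (simp add: unitary_matrix_def)

lemma unitary_matrix_mult:
  assumes "unitary_matrix N A" "unitary_matrix N B"
  shows "unitary_matrix N (A * B)"
proof (rule unitary_matrixI)
  have carr: "A \<in> carrier_mat N N" "B \<in> carrier_mat N N" "mat_adjoint A \<in> carrier_mat N N"
      "mat_adjoint B \<in> carrier_mat N N"
    using assms by (auto simp: unitary_matrix_def mat_adjoint_carrier)
  then show "A * B \<in> carrier_mat N N" by simp
  have "A * B * mat_adjoint (A * B) = A * (B * mat_adjoint B) * mat_adjoint A"
    using carr by (simp add: mat_adjoint_mult assoc_mult_mat[of _ N N _ N _ N])
  then show "A * B * mat_adjoint (A * B) = 1\<^sub>m N"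
    using assms carr by (simp add: unitary_matrix_def)
qed

section \<open>Two-level matrices and Givens rotations\<close>

definition two_level_matrix ::
  "nat \<Rightarrow> nat \<Rightarrow> nat \<Rightarrow> complex \<Rightarrow> complex \<Rightarrow> complex \<Rightarrow> complex \<Rightarrow> complex mat" where
  "two_level_matrix N c r p q s t = mat N N (\<lambda>(i, j).
     if i = c then if j = c then p else if j = r then q else 0
     else if i = r then if j = c then s else if j = r then t else 0
     else if i = j then 1 else 0)"

lemma two_level_matrix_carrier [simp]: "two_level_matrix N c r p q s t \<in> carrier_mat N N"
  by (simp add: two_level_matrix_def)

lemma index_two_level_matrix_mult:
  assumes "c < N" "r < N" "c \<noteq> r" "B \<in> carrier_mat N N" "i < N" "j < N"
  shows "(two_level_matrix N c r p q s t * B) $$ (i, j) =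
    (if i = c then p * B $$ (c, j) + q * B $$ (r, j)
     else if i = r then s * B $$ (c, j) + t * B $$ (r, j)
     else B $$ (i, j))"
proof -
  have "(two_level_matrix N c r p q s t * B) $$ (i, j) =
      (\<Sum>k<N. two_level_matrix N c r p q s t $$ (i, k) * B $$ (k, j))"
    using assms by (intro index_mult_square) auto
  \<comment> \<open>Each row has at most two nonzero entries, so the summand becomes a sum of terms
    supported at single indices.\<close>
  also have "\<dots> = (\<Sum>k<N.
      if i = c then (if k = c then p * B $$ (c, j) else 0) + (if k = r then q * B $$ (r, j) else 0)
      else if i = r then (if k = c then s * B $$ (c, j) else 0) + (if k = r then t * B $$ (r, j) else 0)
      else if k = i then B $$ (i, j) else 0)"
    using assms by (intro sum.cong) (auto simp: two_level_matrix_def)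
  also have "\<dots> = (if i = c then p * B $$ (c, j) + q * B $$ (r, j)
     else if i = r then s * B $$ (c, j) + t * B $$ (r, j)
     else B $$ (i, j))"
    using assms by (cases "i = c"; cases "i = r") (simp_all add: sum.distrib)
  finally show ?thesis .
qed

lemma mat_adjoint_two_level_matrix:
  assumes "c \<noteq> r"
  shows "mat_adjoint (two_level_matrix N c r p q s t) =
    two_level_matrix N c r (cnj p) (cnj s) (cnj q) (cnj t)"
proof (rule eq_matI)
  fix i j
  assume "i < dim_row (two_level_matrix N c r (cnj p) (cnj s) (cnj q) (cnj t))"
    "j < dim_col (two_level_matrix N c r (cnj p) (cnj s) (cnj q) (cnj t))"
  then have "i < N" "j < N" by (auto simp: two_level_matrix_def)
  then show "mat_adjoint (two_level_matrix N c r p q s t) $$ (i, j) =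
      two_level_matrix N c r (cnj p) (cnj s) (cnj q) (cnj t) $$ (i, j)"
    using assms by (simp add: index_mat_adjoint[of _ N]) (auto simp: two_level_matrix_def)
qed (auto simp: mat_adjoint_def two_level_matrix_def)

lemma two_level_unitary_two_level_matrix:
  assumes "c < N" "r < N" "c \<noteq> r"
    and "p * cnj p + q * cnj q = 1" "p * cnj s + q * cnj t = 0" "s * cnj s + t * cnj t = 1"
  shows "two_level_unitary N c r (two_level_matrix N c r p q s t)"
proof -
  have sp: "s * cnj p + t * cnj q = 0"
    using arg_cong[OF assms(5), of cnj] by (simp add: mult.commute)
  have "two_level_matrix N c r p q s t * two_level_matrix N c r (cnj p) (cnj s) (cnj q) (cnj t) = 1\<^sub>m N"
  proof (rule eq_matI)
    fix i j assume "i < dim_row (1\<^sub>m N)" "j < dim_col (1\<^sub>m N)"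
    then have ij: "i < N" "j < N" by simp_all
    show "(two_level_matrix N c r p q s t * two_level_matrix N c r (cnj p) (cnj s) (cnj q) (cnj t)) $$ (i, j) =
        1\<^sub>m N $$ (i, j)"
      unfolding index_two_level_matrix_mult[OF assms(1-3) two_level_matrix_carrier ij]
      using ij assms sp by (auto simp: two_level_matrix_def)
  qed (auto simp: two_level_matrix_def)
  then have "unitary_matrix N (two_level_matrix N c r p q s t)"
    using assms(3) by (intro unitary_matrixI) (simp_all add: mat_adjoint_two_level_matrix)
  then show ?thesis
    unfolding two_level_unitary_def by (auto simp: two_level_matrix_def)
qed

lemma unimodular_rotation:
  obtains u where "u * cnj u = 1" "u * w = of_real (cmod w)"
proof (cases "w = 0")
  case True
  then show ?thesis using that[of 1] by simp
next
  case False
  have "cnj w * w = of_real (cmod w) * of_real (cmod w)"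
    using complex_norm_square[of w] by (simp add: power2_eq_square mult.commute)
  then show ?thesis
    using False by (intro that[of "cnj w / of_real (cmod w)"]) (simp_all add: mult.commute)
qed

text \<open>
  The second row is determined up to a phase \<open>u\<close>. Using it to make the image of \<open>y\<close> nonnegative is
  what forces the final product to be exactly the identity.
\<close>

lemma givens_coefficients:
  fixes a b x y :: complex
  obtains p q s t where "p * cnj p + q * cnj q = 1" "p * cnj s + q * cnj t = 0"
    "s * cnj s + t * cnj t = 1" "p * a + q * b = of_real (cmod (p * a + q * b))"
    "s * a + t * b = 0" "s * x + t * y = of_real (cmod (s * x + t * y))"
proof -
  \<comment> \<open>The unit vector is \<open>(a, b)\<close> divided by its norm
    \<open>\<rho>\<close>, or \<open>(1, 0)\<close> if both vanish. Its conjugate becomes the first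
    row of the rotation.\<close>
  obtain \<alpha> \<beta> \<rho> where \<alpha>\<beta>: "\<alpha> * cnj \<alpha> + \<beta> * cnj \<beta> = 1" "\<alpha> * b = \<beta> * a"
      "cnj \<alpha> * a + cnj \<beta> * b = of_real \<rho>" "\<rho> \<ge> 0"
  proof (cases "a = 0 \<and> b = 0")
    case True
    then show ?thesis using that[of 1 0 0] by simp
  next
    case False
    define \<rho> where "\<rho> = sqrt ((cmod a)\<^sup>2 + (cmod b)\<^sup>2)"
    have "(cmod a)\<^sup>2 + (cmod b)\<^sup>2 > 0" using False by (simp add: sum_power2_gt_zero_iff)
    then have \<rho>: "\<rho> > 0" "\<rho>\<^sup>2 = (cmod a)\<^sup>2 + (cmod b)\<^sup>2" by (auto simp: \<rho>_def)
    then have sq: "a * cnj a + b * cnj b = of_real \<rho> * of_real \<rho>"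
      by (metis complex_norm_square of_real_add of_real_mult power2_eq_square)
    show ?thesis
      using \<rho>(1) sq
      by (intro that[of "a / of_real \<rho>" "b / of_real \<rho>" \<rho>])
        (simp_all add: mult.commute flip: add_divide_distrib)
  qed
  obtain u where u: "u * cnj u = 1" "u * (\<alpha> * y - \<beta> * x) = of_real (cmod (\<alpha> * y - \<beta> * x))"
    using unimodular_rotation by blast
  have w: "- \<beta> * u * x + \<alpha> * u * y = of_real (cmod (\<alpha> * y - \<beta> * x))"
    unfolding u(2)[symmetric] by (simp add: algebra_simps)
  show ?thesis
  proof (rule that)
    show "cnj \<alpha> * cnj (cnj \<alpha>) + cnj \<beta> * cnj (cnj \<beta>) = 1"
      using \<alpha>\<beta>(1) by (simp add: mult.commute)
    show "cnj \<alpha> * cnj (- \<beta> * u) + cnj \<beta> * cnj (\<alpha> * u) = 0" by simp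
    have "- \<beta> * u * cnj (- \<beta> * u) + \<alpha> * u * cnj (\<alpha> * u) = (\<alpha> * cnj \<alpha> + \<beta> * cnj \<beta>) * (u * cnj u)"
      by (simp add: algebra_simps)
    then show "- \<beta> * u * cnj (- \<beta> * u) + \<alpha> * u * cnj (\<alpha> * u) = 1"
      by (simp only: \<alpha>\<beta>(1) u(1) mult_1)
    show "cnj \<alpha> * a + cnj \<beta> * b = of_real (cmod (cnj \<alpha> * a + cnj \<beta> * b))"
      unfolding \<alpha>\<beta>(3) using \<alpha>\<beta>(4) by simp
    have "- \<beta> * u * a + \<alpha> * u * b = u * (\<alpha> * b - \<beta> * a)"
      by (simp add: algebra_simps)
    then show "- \<beta> * u * a + \<alpha> * u * b = 0" using \<alpha>\<beta>(2) by simp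
    show "- \<beta> * u * x + \<alpha> * u * y = of_real (cmod (- \<beta> * u * x + \<alpha> * u * y))"
      unfolding w by simp
  qed
qed

text \<open>The coefficients are taken for \<open>(a, b)\<close> from column \<open>c\<close> and
  \<open>(x, y)\<close> from column \<open>r\<close>, so both diagonal entries become real and
  nonnegative, which is what the equations with \<open>cmod\<close> express. \<open>V\<close> is the
  adjoint of the rotation, since \<open>eliminate\<close> multiplies by adjoints. The last clause
  lets zeros in finished columns persist.\<close>

lemma givens_step:
  fixes A :: "complex mat"
  assumes "A \<in> carrier_mat N N" "c < r" "r < N"
  obtains V B where "two_level_unitary N c r V" "B = mat_adjoint V * A" "B $$ (r, c) = 0"
    "B $$ (c, c) = of_real (cmod (B $$ (c, c)))" "B $$ (r, r) = of_real (cmod (B $$ (r, r)))"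
    "\<And>i j. i < N \<Longrightarrow> j < N \<Longrightarrow> i \<noteq> c \<Longrightarrow> i \<noteq> r \<Longrightarrow> B $$ (i, j) = A $$ (i, j)"
    "\<And>i j. i < N \<Longrightarrow> j < N \<Longrightarrow> A $$ (c, j) = 0 \<Longrightarrow> A $$ (r, j) = 0 \<Longrightarrow> A $$ (i, j) = 0 \<Longrightarrow>
      B $$ (i, j) = 0"
proof -
  obtain p q s t where pqst: "p * cnj p + q * cnj q = 1" "p * cnj s + q * cnj t = 0"
    "s * cnj s + t * cnj t = 1"
    "p * A $$ (c, c) + q * A $$ (r, c) = of_real (cmod (p * A $$ (c, c) + q * A $$ (r, c)))"
    "s * A $$ (c, c) + t * A $$ (r, c) = 0"
    "s * A $$ (c, r) + t * A $$ (r, r) = of_real (cmod (s * A $$ (c, r) + t * A $$ (r, r)))"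
    using givens_coefficients by metis
  let ?M = "two_level_matrix N c r p q s t"
  have cr: "c < N" "c \<noteq> r" using assms by auto
  have "two_level_unitary N c r ?M"
    using cr assms pqst by (intro two_level_unitary_two_level_matrix)
  then have "unitary_matrix N (mat_adjoint ?M)"
    by (simp add: two_level_unitary_def unitary_matrix_adjoint)
  then have V: "two_level_unitary N c r (mat_adjoint ?M)"
    unfolding two_level_unitary_def mat_adjoint_two_level_matrix[OF cr(2)]
    by (auto simp: two_level_matrix_def)
  have B: "?M * A = mat_adjoint (mat_adjoint ?M) * A"
    by (simp add: mat_adjoint_mat_adjoint[of _ N])
  note idx = index_two_level_matrix_mult[OF cr(1) assms(3) cr(2) assms(1)]
  show ?thesis
  proof (rule that[OF V B])
    show "(?M * A) $$ (r, c) = 0" using idx[of r c] cr assms pqst(5) by simp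
    show "(?M * A) $$ (c, c) = of_real (cmod ((?M * A) $$ (c, c)))"
      using idx[of c c p q s t] cr assms pqst(4) by simp
    show "(?M * A) $$ (r, r) = of_real (cmod ((?M * A) $$ (r, r)))"
      using idx[of r r p q s t] cr assms pqst(6) by simp
    show "(?M * A) $$ (i, j) = A $$ (i, j)" if "i < N" "j < N" "i \<noteq> c" "i \<noteq> r" for i j
      using idx[of i j] that by simp
    show "(?M * A) $$ (i, j) = 0"
      if "i < N" "j < N" "A $$ (c, j) = 0" "A $$ (r, j) = 0" "A $$ (i, j) = 0" for i j
      using idx[of i j] that by simp
  qed
qed

text \<open>By induction on the row: column \<open>i\<close> is zero off the diagonal, below by
  triangularity and above by the earlier rows. Orthonormality of the columns then determines row
  \<open>i\<close>, and nonnegativity excludes every phase other than 1.\<close>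

lemma upper_triangular_unitary_eq_one:
  assumes U: "unitary_matrix N A"
    and zero: "\<And>i j. j < i \<Longrightarrow> i < N \<Longrightarrow> A $$ (i, j) = 0"
    and diag: "\<And>i. i < N \<Longrightarrow> A $$ (i, i) = of_real (cmod (A $$ (i, i)))"
  shows "A = 1\<^sub>m N"
proof -
  have carr: "A \<in> carrier_mat N N" using U by (rule unitary_matrix_carrier)
  have row: "\<forall>j<N. A $$ (i, j) = (if i = j then 1 else 0)" if "i < N" for i
    using that
  proof (induction i rule: less_induct)
    case (less i)
    have col: "A $$ (k, i) = 0" if "k < N" "k \<noteq> i" for k
      using that less zero by (metis linorder_neqE_nat)
    have prod: "cnj (A $$ (i, i)) * A $$ (i, j) = (if i = j then 1 else 0)" if "j < N" for j
    proof -
      have "(mat_adjoint A * A) $$ (i, j) = (if i = j then 1 else 0)"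
        using U less.prems that by (simp add: unitary_matrix_def)
      moreover have "(mat_adjoint A * A) $$ (i, j) = (\<Sum>k<N. cnj (A $$ (k, i)) * A $$ (k, j))"
        using carr less.prems that
        by (simp add: index_mult_square[of _ N] mat_adjoint_carrier index_mat_adjoint[of _ N] del: index_mult_mat)
      moreover have "\<dots> = (\<Sum>k<N. if k = i then cnj (A $$ (i, i)) * A $$ (i, j) else 0)"
        using col by (intro sum.cong) auto
      ultimately show ?thesis using less.prems by simp
    qed
    define \<rho> where "\<rho> = cmod (A $$ (i, i))"
    have d: "A $$ (i, i) = of_real \<rho>" "\<rho> \<ge> 0" using diag[OF less.prems] by (auto simp: \<rho>_def)
    have "of_real (\<rho> * \<rho>) = (1 :: complex)" using prod[OF less.prems] d by simp
    then have "\<rho> * \<rho> = 1" using of_real_eq_1_iff by blast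
    then have "\<rho> = 1" using d(2) by (simp add: square_eq_1_iff)
    then have one: "A $$ (i, i) = 1" using d by simp
    show ?case using prod unfolding one by simp
  qed
  show ?thesis using carr row by (intro eq_matI) auto
qed

section \<open>The elimination process\<close>

lemma eliminate_snoc: "eliminate (Vs @ [V]) U = mat_adjoint V * eliminate Vs U"
  by (simp add: eliminate_def)

text \<open>The factors undo their adjoints one by one; if the eliminated matrix is the identity,
  this is the factorization of \<open>U\<close>.\<close>

lemma foldr_mult_eliminate:
  assumes "\<forall>V\<in>set Vs. unitary_matrix N V" "U \<in> carrier_mat N N"
  shows "foldr (*) Vs (eliminate Vs U) = U"
  using assms
proof (induction Vs arbitrary: U)
  case (Cons V Vs)
  have carr: "V \<in> carrier_mat N N" "mat_adjoint V \<in> carrier_mat N N"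
    using Cons.prems by (auto simp: unitary_matrix_def mat_adjoint_carrier)
  have "foldr (*) (V # Vs) (eliminate (V # Vs) U) = V * foldr (*) Vs (eliminate Vs (mat_adjoint V * U))"
    by (simp add: eliminate_def)
  also have "\<dots> = V * (mat_adjoint V * U)"
    using Cons carr by simp
  also have "\<dots> = V * mat_adjoint V * U"
    using carr Cons.prems by (simp add: assoc_mult_mat[of _ N N _ N _ N])
  also have "\<dots> = U" using Cons.prems by (simp add: unitary_matrix_def)
  finally show ?case .
qed (simp add: eliminate_def)

text \<open>The invariant keeps all treated entries zero and the diagonal entries of all begun
  columns nonnegative. The last clause, proved afresh at each step, is there for the bottom diagonal
  entry, whose column contains no pair.\<close>

lemma two_level_elimination:
  fixes ps :: "(nat \<times> nat) list"
  assumes ps: "distinct ps" "set ps = {(r, c). c < r \<and> r < N}" "sorted (map snd ps)"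
    and U: "unitary_matrix N U" and "k \<le> length ps"
  shows "\<exists>Vs. length Vs = k \<and>
    (\<forall>j<k. two_level_unitary N (snd (ps ! j)) (fst (ps ! j)) (Vs ! j) \<and>
      eliminate (take (Suc j) Vs) U $$ (ps ! j) = 0) \<and>
    unitary_matrix N (eliminate Vs U) \<and>
    (\<forall>(r, c)\<in>set (take k ps). eliminate Vs U $$ (r, c) = 0 \<and>
       eliminate Vs U $$ (c, c) = of_real (cmod (eliminate Vs U $$ (c, c)))) \<and>
    (0 < k \<longrightarrow> (let r = fst (ps ! (k - 1)) in
       eliminate Vs U $$ (r, r) = of_real (cmod (eliminate Vs U $$ (r, r)))))"
  using assms(5)
proof (induction k)
  case 0
  then show ?case using U by (simp add: eliminate_def)
next
  case (Suc k)
  then obtain Vs where Vs: "length Vs = k"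
    "\<forall>j<k. two_level_unitary N (snd (ps ! j)) (fst (ps ! j)) (Vs ! j) \<and>
      eliminate (take (Suc j) Vs) U $$ (ps ! j) = 0"
    "unitary_matrix N (eliminate Vs U)"
    "\<forall>(r, c)\<in>set (take k ps). eliminate Vs U $$ (r, c) = 0 \<and>
       eliminate Vs U $$ (c, c) = of_real (cmod (eliminate Vs U $$ (c, c)))"
    by auto
  let ?A = "eliminate Vs U"
  have k: "k < length ps" using Suc.prems by simp
  obtain r c where rc: "ps ! k = (r, c)" by force
  then have lt: "c < r" "r < N" using ps(2) nth_mem[OF k] by auto
  obtain V B where V: "two_level_unitary N c r V" and B: "B = mat_adjoint V * ?A" "B $$ (r, c) = 0"
    "B $$ (c, c) = of_real (cmod (B $$ (c, c)))" "B $$ (r, r) = of_real (cmod (B $$ (r, r)))"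
    "\<And>i j. i < N \<Longrightarrow> j < N \<Longrightarrow> i \<noteq> c \<Longrightarrow> i \<noteq> r \<Longrightarrow> B $$ (i, j) = ?A $$ (i, j)"
    "\<And>i j. i < N \<Longrightarrow> j < N \<Longrightarrow> ?A $$ (c, j) = 0 \<Longrightarrow> ?A $$ (r, j) = 0 \<Longrightarrow> ?A $$ (i, j) = 0 \<Longrightarrow>
      B $$ (i, j) = 0"
    using givens_step[OF unitary_matrix_carrier[OF Vs(3)] lt] by blast
  have elim: "eliminate (Vs @ [V]) U = B" by (simp add: eliminate_snoc B(1))
  have mono: "snd (ps ! i) \<le> snd (ps ! j)" if "i \<le> j" "j < length ps" for i j
    using sorted_nth_mono[OF ps(3) that(1)] that by simp
  \<comment> \<open>Sortedness puts every pair of a smaller column before position \<open>k\<close>,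
    so those columns are already cleared.\<close>
  have earlier: "(r', c') \<in> set (take k ps)" if "c' < c" "c' < r'" "r' < N" for r' c'
  proof -
    have "(r', c') \<in> set ps" using ps(2) that by simp
    then obtain j where j: "j < length ps" "ps ! j = (r', c')" by (auto simp: in_set_conv_nth)
    have "j < k"
    proof (rule ccontr)
      assume "\<not> j < k"
      then show False using mono[of k j] j rc that by simp
    qed
    then show ?thesis using j by (force simp: in_set_conv_nth)
  qed
  have inv: "B $$ (r', c') = 0 \<and> B $$ (c', c') = of_real (cmod (B $$ (c', c')))"
    if mem: "(r', c') \<in> set (take k ps)" for r' c'
  proof -
    obtain j where j: "j < k" "ps ! j = (r', c')" using mem k by (auto simp: in_set_conv_nth)
    have "(r', c') \<in> set ps" using mem by (rule in_set_takeD)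
    then have lt': "c' < r'" "r' < N" using ps(2) by auto
    have A: "?A $$ (r', c') = 0" "?A $$ (c', c') = of_real (cmod (?A $$ (c', c')))"
      using Vs(4) mem by auto
    have "c' \<le> c" using mono[of j k] j rc k by simp
    then consider "c' = c" | "c' < c" by linarith
    then show ?thesis
    proof cases
      \<comment> \<open>In the current column, row \<open>r'\<close> is untouched and the rotation
        itself makes the diagonal entry nonnegative.\<close>
      case 1
      then have "r' \<noteq> r" using nth_eq_iff_index_eq[OF ps(1), of j k] j rc k by auto
      then show ?thesis using 1 B(3,5) A lt lt' by simp
    next
      \<comment> \<open>In an earlier column both rotated rows already hold zeros, and the diagonal
        entry lies in neither of these rows.\<close>
      case 2
      then have "?A $$ (c, c') = 0" "?A $$ (r, c') = 0"
        using Vs(4) earlier[of c' c] earlier[of c' r] lt by auto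
      then have "B $$ (r', c') = 0" using B(6)[of r' c'] A lt' by simp
      moreover have "B $$ (c', c') = ?A $$ (c', c')" using B(5) 2 lt lt' by simp
      ultimately show ?thesis using A by simp
    qed
  qed
  have nth: "(Vs @ [V]) ! j = Vs ! j" "take (Suc j) (Vs @ [V]) = take (Suc j) Vs" if "j < k" for j
    using that Vs(1) by (simp_all add: nth_append)
  have "unitary_matrix N (mat_adjoint V)"
    using V by (simp add: two_level_unitary_def unitary_matrix_adjoint)
  then have "unitary_matrix N B" using B(1) Vs(3) by (simp add: unitary_matrix_mult)
  moreover have "\<forall>j<Suc k. two_level_unitary N (snd (ps ! j)) (fst (ps ! j)) ((Vs @ [V]) ! j) \<and>
      eliminate (take (Suc j) (Vs @ [V])) U $$ (ps ! j) = 0"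
  proof (intro allI impI)
    fix j assume "j < Suc k"
    then consider "j < k" | "j = k" by linarith
    then show "two_level_unitary N (snd (ps ! j)) (fst (ps ! j)) ((Vs @ [V]) ! j) \<and>
        eliminate (take (Suc j) (Vs @ [V])) U $$ (ps ! j) = 0"
    proof cases
      case 1
      then show ?thesis using Vs(2) nth by simp
    next
      case 2
      then have "(Vs @ [V]) ! j = V" "take (Suc j) (Vs @ [V]) = Vs @ [V]"
        using Vs(1) by (simp_all add: nth_append)
      then show ?thesis using 2 V rc B(2) elim by simp
    qed
  qed
  moreover have "set (take (Suc k) ps) = insert (r, c) (set (take k ps))"
    using k rc by (simp add: take_Suc_conv_app_nth)
  ultimately show ?case
    using Vs(1) B(2,3,4) inv rc elim by (intro exI[of _ "Vs @ [V]"]) auto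
qed

lemma two_level_decomposition_exists:
  assumes "1 \<le> n" "fixed_column_ordering n ps" "unitary_matrix (2 ^ n) U"
  shows "\<exists>Vs. two_level_decomposition n U ps Vs"
proof -
  let ?N = "2 ^ n :: nat"
  have ps: "distinct ps" "set ps = {(r, c). c < r \<and> r < ?N}" "sorted (map snd ps)"
    using assms by (simp_all add: fixed_column_ordering_def)
  obtain Vs where Vs: "length Vs = length ps"
    "\<forall>j<length ps. two_level_unitary ?N (snd (ps ! j)) (fst (ps ! j)) (Vs ! j) \<and>
      eliminate (take (Suc j) Vs) U $$ (ps ! j) = 0"
    and U: "unitary_matrix ?N (eliminate Vs U)"
    and inv: "\<forall>(r, c)\<in>set ps. eliminate Vs U $$ (r, c) = 0 \<and>
       eliminate Vs U $$ (c, c) = of_real (cmod (eliminate Vs U $$ (c, c)))"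
    and last: "0 < length ps \<longrightarrow> (let r = fst (ps ! (length ps - 1)) in
       eliminate Vs U $$ (r, r) = of_real (cmod (eliminate Vs U $$ (r, r))))"
    using two_level_elimination[OF ps assms(3) order_refl] by auto
  have N: "2 \<le> ?N" using assms(1) by (metis one_le_numeral power_increasing power_one_right)
  \<comment> \<open>This pair has the largest column, so by sortedness the final pair lies in that
    column too and its row can only be \<open>?N - 1\<close>. The last clause of the invariant thus
    covers the bottom diagonal entry.\<close>
  have "(?N - 1, ?N - 2) \<in> set ps" unfolding ps(2) using N by auto
  then obtain j where j: "j < length ps" "ps ! j = (?N - 1, ?N - 2)" by (auto simp: in_set_conv_nth)
  obtain r c where rc: "ps ! (length ps - 1) = (r, c)" by force
  have "?N - 2 \<le> c"
    using sorted_nth_mono[OF ps(3), of j "length ps - 1"] j rc by simp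
  moreover have "(r, c) \<in> set ps" using rc j(1) by (metis diff_less gr_implies_not0 less_one linorder_neqE_nat nth_mem)
  then have "c < r" "r < ?N" unfolding ps(2) by simp_all
  ultimately have r: "r = ?N - 1" by linarith
  have "eliminate Vs U = 1\<^sub>m ?N"
  proof (rule upper_triangular_unitary_eq_one[OF U])
    fix i j assume "j < i" "i < ?N"
    then show "eliminate Vs U $$ (i, j) = 0" using inv ps(2) by auto
  next
    fix i assume i: "i < ?N"
    show "eliminate Vs U $$ (i, i) = of_real (cmod (eliminate Vs U $$ (i, i)))"
    proof (cases "i = ?N - 1")
      case True
      have "0 < length ps" using j(1) by linarith
      then show ?thesis using last True r rc by (simp add: Let_def)
    next
      case False
      then have "(Suc i, i) \<in> set ps" unfolding ps(2) using i by simp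
      then show ?thesis using inv by blast
    qed
  qed
  moreover have "\<forall>V\<in>set Vs. unitary_matrix ?N V"
    using Vs by (auto simp: in_set_conv_nth two_level_unitary_def)
  ultimately have "U = foldr (*) Vs (1\<^sub>m ?N)"
    using foldr_mult_eliminate[of Vs ?N U] assms(3) unitary_matrix_carrier by metis
  then show ?thesis
    using Vs unfolding two_level_decomposition_def by (auto simp: case_prod_beta)
qed

section \<open>Counting controlled-NOT gates\<close>

lemma list_all_palindrome_half: "list_all is_CNOT (palindrome_half n c r)"
  by (auto simp: palindrome_half_def Let_def list_all_iff)

text \<open>Middle gates are not counted, so the number before cancellation depends on the pairs but
  not on the matrices.\<close>

lemma cnot_count_circuit_subcircuits:
  assumes "length Vs = length ps"
  shows "cnot_count (circuit (subcircuits n ps Vs)) =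
    (\<Sum>(r, c)\<leftarrow>ps. 2 * length (palindrome_half n c r))"
  using assms
proof (induction Vs ps rule: list_induct2)
  case (Cons V Vs p ps)
  obtain r c where p: "p = (r, c)" by force
  have "filter is_CNOT (palindrome_half n c r) = palindrome_half n c r"
    using list_all_palindrome_half by (intro filter_True) (auto simp: list_all_iff)
  then show ?case
    using Cons.IH
    by (simp add: p subcircuits_def circuit_def cnot_count_def middle_gate_def Let_def flip: rev_filter)
qed (simp add: subcircuits_def circuit_def cnot_count_def)

text \<open>The left side is unchanged when the pairs are permuted, so fewest gates after
  cancellation means largest total overlap.\<close>

lemma cnot_count_cancelled_circuit:
  assumes "length Vs = length ps"
  shows "(\<Sum>(r, c)\<leftarrow>ps. 2 * length (palindrome_half n c r)) =
    cnot_count (cancelled_circuit (subcircuits n ps Vs)) + 2 * total_overlap n ps"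
proof -
  let ?Ss = "subcircuits n ps Vs"
  have len: "length ?Ss = length ps" using assms by (simp add: subcircuits_def)
  have fst_nth: "fst (?Ss ! j) = map (\<lambda>(r, c). palindrome_half n c r) ps ! j" if "j < length ps" for j
    using that assms by (simp add: subcircuits_def case_prod_beta)
  have "list_all is_CNOT \<alpha>" if "(\<alpha>, \<beta>) \<in> set ?Ss" for \<alpha> \<beta>
    using that by (auto simp: subcircuits_def list_all_palindrome_half)
  from cnot_count_circuit[of ?Ss, OF this] show ?thesis
    unfolding cnot_count_circuit_subcircuits[OF assms] total_overlap_def Let_def len
    by (simp add: fst_nth)
qed

text \<open>Nonemptiness of the set of optimized circuits keeps the minimality claim from being
  vacuous. Minimality is stated for every choice of decomposition on either side.\<close>

theorem theorem2:
  fixes n :: nat and U :: "complex mat"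
  assumes "n \<ge> 2"
    and "unitary_matrix (2 ^ n) U"
  shows "fixed_column_ordering n (poa_ordering n) \<and>
    (\<forall>ps. fixed_column_ordering n ps \<longrightarrow>
       total_overlap n ps \<le> total_overlap n (poa_ordering n)) \<and>
    optimized_circuits n U (poa_ordering n) \<noteq> {} \<and>
    (\<forall>C \<in> optimized_circuits n U (poa_ordering n).
       \<forall>ps. fixed_column_ordering n ps \<longrightarrow>
         (\<forall>C' \<in> optimized_circuits n U ps. cnot_count C \<le> cnot_count C'))"
proof (intro conjI allI impI ballI)
  show poa: "fixed_column_ordering n (poa_ordering n)"
    using assms(1) by (rule fixed_column_ordering_poa)
  show le: "total_overlap n ps \<le> total_overlap n (poa_ordering n)"
    if "fixed_column_ordering n ps" for ps
    using assms(1) that by (rule total_overlap_le_poa)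
  show "optimized_circuits n U (poa_ordering n) \<noteq> {}"
    using two_level_decomposition_exists[OF _ poa assms(2)] assms(1)
    by (auto simp: optimized_circuits_def)
  fix C ps C'
  assume C: "C \<in> optimized_circuits n U (poa_ordering n)" and ps: "fixed_column_ordering n ps"
    and C': "C' \<in> optimized_circuits n U ps"
  let ?f = "\<lambda>(r, c). 2 * length (palindrome_half n c r)"
  have total: "sum_list (map ?f qs) = cnot_count D + 2 * total_overlap n qs"
    if D: "D \<in> optimized_circuits n U qs" for D qs
  proof -
    obtain Vs where "D = cancelled_circuit (subcircuits n qs Vs)" "length Vs = length qs"
      using D by (auto simp: optimized_circuits_def two_level_decomposition_def)
    then show ?thesis using cnot_count_cancelled_circuit by simp
  qed
  \<comment> \<open>Both orderings list the same pairs once each, so the counts before cancellation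
    agree.\<close>
  have "distinct ps" "distinct (poa_ordering n)" "set ps = set (poa_ordering n)"
    using ps poa by (simp_all add: fixed_column_ordering_def)
  then have "sum_list (map ?f ps) = sum_list (map ?f (poa_ordering n))"
    by (simp only: sum_list_distinct_conv_sum_set)
  then show "cnot_count C \<le> cnot_count C'"
    using total[OF C] total[OF C'] le[OF ps] by linarith
qed

end
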